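(* For every integer $t \geq 1$ and every integer $n \geq 4t$, there exists an optimal outerthickness-$t$ graph on $n$ vertices.
   Context: A graph is outerplanar if it admits a crossing-free drawing in the plane with all vertices on the outer face. The outerthickness of a graph $G$ is the minimum number $t$ such that $E(G)$ admits a partition $\{E_0,\dots,E_{t-1}\}$ with $(V(G),E_i)$ outerplanar for every $i$. A graph $G$ with $n \geq 3$ vertices, $m$ edges and outerthickness $t \geq 1$ is an optimal outerthickness-$t$ graph if $m = t(2n-3)$. *)

theory Defs
  imports "HOL-Analysis.Analysis" "HOL-Library.Disjoint_Sets"
begin

definition simple_graph :: "'a set \<Rightarrow> 'a set set \<Rightarrow> bool" where
  "simple_graph V E \<longleftrightarrow> finite V \<and> E \<subseteq> {e. e \<subseteq> V \<and> card e = 2}"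

(* The plane is the type complex. The vertex v is drawn as the point p v and the edge e as
   the simple arc g e, in either orientation. Arcs meet vertices and each other only at
   common ends. *)
definition plane_drawing ::
  "'a set \<Rightarrow> 'a set set \<Rightarrow> ('a \<Rightarrow> complex) \<Rightarrow> ('a set \<Rightarrow> real \<Rightarrow> complex) \<Rightarrow> bool" where
  "plane_drawing V E p g \<longleftrightarrow>
     inj_on p V \<and>
     (\<forall>e\<in>E. arc (g e) \<and> {pathstart (g e), pathfinish (g e)} = p ` e \<and>
             path_image (g e) \<inter> p ` V = p ` e) \<and>
     (\<forall>e\<in>E. \<forall>f\<in>E. e \<noteq> f \<longrightarrow> path_image (g e) \<inter> path_image (g f) \<subseteq> p ` (e \<inter> f))"

definition drawing_image ::
  "'a set \<Rightarrow> 'a set set \<Rightarrow> ('a \<Rightarrow> complex) \<Rightarrow> ('a set \<Rightarrow> real \<Rightarrow> complex) \<Rightarrow> complex set" where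
  "drawing_image V E p g = p ` V \<union> (\<Union>e\<in>E. path_image (g e))"

(* For a finite graph the drawing is compact, so its outside is the unique unbounded
   component of the complement, that is, the outer face. A vertex is on the outer face if
   it lies on the boundary of that face. *)
definition outerplanar :: "'a set \<Rightarrow> 'a set set \<Rightarrow> bool" where
  "outerplanar V E \<longleftrightarrow> simple_graph V E \<and>
     (\<exists>p g. plane_drawing V E p g \<and> p ` V \<subseteq> frontier (outside (drawing_image V E p g)))"

(* The members of a partition_on are nonempty; admitting empty classes would not change
   the minimum. *)
definition outerthickness :: "'a set \<Rightarrow> 'a set set \<Rightarrow> nat" where
  "outerthickness V E =
     (LEAST t. \<exists>P. partition_on E P \<and> finite P \<and> card P = t \<and> (\<forall>F\<in>P. outerplanar V F))"

definition optimal_outerthickness_graph :: "nat \<Rightarrow> 'a set \<Rightarrow> 'a set set \<Rightarrow> bool" where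
  "optimal_outerthickness_graph t V E \<longleftrightarrow>
     simple_graph V E \<and> card V \<ge> 3 \<and> t \<ge> 1 \<and> outerthickness V E = t \<and>
     card E = t * (2 * card V - 3)"

end

theory Submission
  imports Defs "HOL-Complex_Analysis.Winding_Numbers"
begin

text \<open>Lower bound: three internally disjoint paths with inner vertices between the same two vertices
  cannot have all their vertices on the outer face, so an outerplanar graph has no subdivision of
  \<open>K\<^bsub>2,3\<^esub>\<close>. Such a graph on \<open>n\<close> vertices has at most \<open>2 * n - 2\<close> edges (\<open>K\<^bsub>4\<^esub>\<close> attains
  this), by deleting a vertex of degree at most 2 or a \<open>K\<^bsub>4\<^esub>\<close> hanging at one vertex. This is one more than
  the sharp bound for outerplanar graphs, but \<open>(t - 1) * (2 * n - 2) < t * (2 * n - 3)\<close> suffices.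

  Construction: for \<open>n = 4 * t\<close>, take two copies of the integers modulo \<open>2 * t\<close> as vertices and label
  a fixed triangulated polygon, symmetric under a half turn, in zigzag order; its \<open>t\<close> rotations
  are edge-disjoint. For larger \<open>n\<close>, a new vertex is inserted into each of the \<open>t\<close> drawings between two
  consecutive vertices. As \<open>n \<ge> 4 * t\<close>, these \<open>t\<close> pairs can be chosen disjoint, so that the new edges
  of different drawings are distinct.\<close>

subsection \<open>Theta curves and the outer face\<close>

locale arc_pair =
  fixes c d :: "real \<Rightarrow> complex" and a b :: complex
  assumes arcs: "arc c" "arc d"
    and ends: "pathstart c = a" "pathfinish c = b" "pathstart d = a" "pathfinish d = b"
    and meet: "path_image c \<inter> path_image d = {a, b}"
begin

lemma simple_loop: "simple_path (c +++ reversepath d)"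
  using arcs ends meet by (intro simple_path_join_loop arc_reversepath) auto

lemma loop_image: "path_image (c +++ reversepath d) = path_image c \<union> path_image d"
  using ends by (simp add: path_image_join)

lemma loop_closed: "pathfinish (c +++ reversepath d) = pathstart (c +++ reversepath d)"
  using ends by simp

lemmas Jordan = Jordan_inside_outside[OF simple_loop loop_closed, unfolded loop_image]

text \<open>The winding number of a single arc need not be an integer; only the difference for two
  arcs with common ends, which is that of the loop, tells inside from outside.\<close>

lemma winding_loop:
  assumes "z \<notin> path_image c \<union> path_image d"
  shows "winding_number (c +++ reversepath d) z = winding_number c z - winding_number d z"
  using assms arcs ends
  by (simp add: winding_number_join winding_number_reversepath arc_imp_path)

lemma winding_inside:
  assumes "z \<in> inside (path_image c \<union> path_image d)"
  shows "winding_number c z \<noteq> winding_number d z"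
proof -
  have "z \<notin> path_image c \<union> path_image d"
    using assms by (meson disjoint_iff inside_no_overlap)
  moreover have "norm (winding_number (c +++ reversepath d) z) = 1"
    using simple_closed_path_norm_winding_number_inside[OF simple_loop] assms
    by (simp add: loop_image)
  ultimately show ?thesis using winding_loop by fastforce
qed

lemma winding_outside:
  assumes "z \<in> outside (path_image c \<union> path_image d)"
  shows "winding_number c z = winding_number d z"
proof -
  have "z \<notin> path_image c \<union> path_image d"
    using assms by (meson disjoint_iff outside_no_overlap)
  moreover have "winding_number (c +++ reversepath d) z = 0"
    using assms winding_number_zero_in_outside[OF _ loop_closed] simple_loop
    by (simp add: loop_image simple_path_imp_path)
  ultimately show ?thesis using winding_loop by fastforce
qed

end

lemma connected_subset_inside:
  fixes S :: "'a::real_normed_vector set"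
  assumes "connected A" "A \<inter> S = {}" "closed S" "A \<inter> inside S \<noteq> {}"
  shows "A \<subseteq> inside S"
proof -
  have "A \<subseteq> inside S \<union> outside S" using assms(2) by auto
  moreover have "inside S \<inter> outside S \<inter> A = {}" by simp
  ultimately have "inside S \<inter> A = {} \<or> outside S \<inter> A = {}"
    using connectedD[OF assms(1) open_inside[OF assms(3)] open_outside[OF assms(3)]] by blast
  with assms(4) \<open>A \<subseteq> inside S \<union> outside S\<close> show ?thesis by blast
qed

text \<open>The open set \<open>inside T\<close> around \<open>x\<close> would contain points of
  \<open>outside S\<close>, and these lie outside the smaller set \<open>T\<close>. Hence a vertex
  on the outer face lies inside no cycle of the drawing.\<close>

lemma closure_outside_disjoint_inside:
  fixes S T :: "complex set"
  assumes "x \<in> closure (outside S)" "T \<subseteq> S" "closed T"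
  shows "x \<notin> inside T"
proof
  assume x: "x \<in> inside T"
  with assms(1) obtain y where "y \<in> outside S" "y \<in> inside T"
    using closure_iff_nhds_not_empty open_inside[OF assms(3)] by (metis IntE all_not_in_conv order_refl)
  then show False using outside_mono[OF assms(2)] inside_Int_outside by blast
qed

text \<open>The winding numbers of the three cycles of a theta curve add up to zero, so a point inside
  one of the cycles lies inside a second one. If no cycle had an arc inside, these two insides
  would coincide, and so would their frontiers.\<close>
lemma no_theta_on_outer_face:
  fixes c :: "nat \<Rightarrow> real \<Rightarrow> complex"
  assumes arcs: "\<And>i. i < 3 \<Longrightarrow> arc (c i) \<and> pathstart (c i) = a \<and> pathfinish (c i) = b"
    and meet: "\<And>i j. i < 3 \<Longrightarrow> j < 3 \<Longrightarrow> i \<noteq> j \<Longrightarrow> path_image (c i) \<inter> path_image (c j) = {a, b}"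
    and outer: "\<And>i. i < 3 \<Longrightarrow> x i \<in> path_image (c i) - {a, b} \<and> x i \<in> closure (outside S)"
    and sub: "\<And>i. i < 3 \<Longrightarrow> path_image (c i) \<subseteq> S"
  shows False
proof -
  let ?C = "\<lambda>i. path_image (c i)"
  let ?I = "\<lambda>i j. inside (?C i \<union> ?C j)"
  have pair: "arc_pair (c i) (c j) a b" if "i < 3" "j < 3" "i \<noteq> j" for i j
    using arcs meet that by unfold_locales auto
  have closed: "closed (?C i \<union> ?C j)" if "i < 3" "j < 3" for i j
    using arcs that by (intro closed_Un closed_path_image arc_imp_path) auto
  \<comment> \<open>An arc without its ends is connected and avoids the other two arcs, so one point
    of it inside their cycle would pull in \<open>x k\<close>, which is a limit of points outside
    \<open>S\<close>.\<close>
  have empty: "?I i j \<inter> ?C k = {}" if ijk: "i < 3" "j < 3" "k < 3" "i \<noteq> j" "k \<noteq> i" "k \<noteq> j" for i j k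
  proof (rule ccontr)
    assume ne: "?I i j \<inter> ?C k \<noteq> {}"
    have "connected (?C k - {a, b})"
      using connected_simple_path_endless[of "c k"] arcs[of k] ijk arc_imp_simple_path by auto
    moreover have "(?C k - {a, b}) \<inter> (?C i \<union> ?C j) = {}" using meet ijk by blast
    moreover have "{a, b} \<subseteq> ?C i" using meet[of i j] ijk by blast
    then have "{a, b} \<inter> ?I i j = {}" using inside_no_overlap by blast
    with ne have "(?C k - {a, b}) \<inter> ?I i j \<noteq> {}" by blast
    ultimately have "?C k - {a, b} \<subseteq> ?I i j"
      using connected_subset_inside closed ijk by metis
    then have "x k \<in> ?I i j" using outer ijk by blast
    moreover have "x k \<notin> ?I i j"
      using closure_outside_disjoint_inside outer[of k] sub[of i] sub[of j] closed[of i j] ijk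
      by (metis le_sup_iff)
    ultimately show False by blast
  qed
  \<comment> \<open>By \<open>empty\<close>, each of the two insides is connected and avoids the
    frontier of the other, so they are equal once they meet. Their frontiers would then be equal,
    but \<open>x j\<close> lies on only one.\<close>
  have disj: "?I i j \<inter> ?I i k = {}" if ijk: "i < 3" "j < 3" "k < 3" "i \<noteq> j" "k \<noteq> i" "k \<noteq> j" for i j k
  proof (rule ccontr)
    assume ne: "?I i j \<inter> ?I i k \<noteq> {}"
    note J = arc_pair.Jordan[OF pair[of i j]] arc_pair.Jordan[OF pair[of i k]]
    have no: "?I i j \<inter> (?C i \<union> ?C j) = {}" "?I i k \<inter> (?C i \<union> ?C k) = {}"
      by simp_all
    have "?I i j \<subseteq> ?I i k"
      using J ijk empty[of i j k] no ne closed[of i k]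
      by (intro connected_subset_inside) (auto simp: Int_commute)
    moreover have "?I i k \<subseteq> ?I i j"
      using J ijk empty[of i k j] no ne closed[of i j]
      by (intro connected_subset_inside) (auto simp: Int_commute)
    ultimately have "?I i j = ?I i k" by blast
    then have "?C i \<union> ?C j = ?C i \<union> ?C k" using J ijk by metis
    moreover have "x j \<notin> ?C i \<union> ?C k" "x j \<in> ?C j"
      using outer[of j] meet[of i j] meet[of j k] ijk by blast+
    ultimately show False by blast
  qed
  have "?I 0 1 \<noteq> {}" using arc_pair.Jordan[OF pair[of 0 1]] by simp
  then obtain z where z: "z \<in> ?I 0 1" by blast
  have "z \<notin> ?C 2" using z empty[of 0 1 2] by auto
  moreover have "z \<notin> ?C 0 \<union> ?C 1" using z inside_no_overlap by blast
  moreover have "z \<notin> ?I 0 2" using z disj[of 0 1 2] by auto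
  moreover have "z \<notin> ?I 1 2" using z disj[of 1 0 2] by (auto simp: Un_commute)
  ultimately have "z \<in> outside (?C 0 \<union> ?C 2)" "z \<in> outside (?C 1 \<union> ?C 2)"
    using inside_Un_outside by blast+
  then have "winding_number (c 0) z = winding_number (c 1) z"
    using arc_pair.winding_outside[OF pair[of 0 2]] arc_pair.winding_outside[OF pair[of 1 2]] by simp
  with z show False using arc_pair.winding_inside[OF pair[of 0 1]] by simp
qed

section \<open>Thetas in graphs and their drawings\<close>

abbreviation walk :: "'a set set \<Rightarrow> 'a list \<Rightarrow> bool" where
  "walk E \<equiv> successively (\<lambda>u v. {u, v} \<in> E)"

text \<open>\<open>X\<close> lists the inner vertices of a path from \<open>a\<close> to
  \<open>b\<close>. It is nonempty because each path of a theta must contribute a vertex besides the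
  two hubs.\<close>

definition link :: "'a set set \<Rightarrow> 'a \<Rightarrow> 'a \<Rightarrow> 'a list \<Rightarrow> bool" where
  "link E a b X \<longleftrightarrow> X \<noteq> [] \<and> distinct (a # X @ [b]) \<and> walk E (a # X @ [b])"

text \<open>Equivalently: the graph contains no subdivision of \<open>K\<^bsub>2,3\<^esub>\<close>.\<close>
definition theta_free :: "'a set set \<Rightarrow> bool" where
  "theta_free E \<longleftrightarrow> \<not> (\<exists>a b X Y Z. link E a b X \<and> link E a b Y \<and> link E a b Z \<and>
     set X \<inter> set Y = {} \<and> set X \<inter> set Z = {} \<and> set Y \<inter> set Z = {})"

fun walk_edges :: "'a list \<Rightarrow> 'a set set" where
  "walk_edges (u # v # xs) = insert {u, v} (walk_edges (v # xs))"
| "walk_edges _ = {}"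

lemma walk_iff_walk_edges: "walk E xs \<longleftrightarrow> walk_edges xs \<subseteq> E"
  by (induction xs rule: walk_edges.induct) auto

lemma walk_edges_subset: "e \<in> walk_edges xs \<Longrightarrow> e \<subseteq> set xs"
  by (induction xs rule: walk_edges.induct) auto

lemma Union_walk_edges: "length xs \<ge> 2 \<Longrightarrow> \<Union>(walk_edges xs) = set xs"
proof (induction xs rule: walk_edges.induct)
  case (1 u v xs)
  then show ?case by (cases xs) auto
qed auto

text \<open>Since \<open>X\<close> is nonempty, \<open>a\<close> and \<open>b\<close> are not
  consecutive. An edge of one path of a theta therefore cannot belong to another path, whose inner
  vertices are different.\<close>

lemma walk_edges_link_meets_inner:
  assumes "distinct (a # X @ [b])" "X \<noteq> []" "e \<in> walk_edges (a # X @ [b])"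
  shows "e \<inter> set X \<noteq> {}"
  using assms
proof (induction X arbitrary: a)
  case (Cons x X)
  then show ?case by (cases "X = []") auto
qed simp

text \<open>The arcs of the edges are joined one after the other, reversed where the drawing runs
  them backwards. The first one meets the rest only in \<open>p v\<close>, because \<open>u\<close>
  does not occur again.\<close>

lemma walk_arc:
  assumes draw: "plane_drawing V E p g"
  shows "walk E xs \<Longrightarrow> distinct xs \<Longrightarrow> length xs \<ge> 2 \<Longrightarrow> set xs \<subseteq> V \<Longrightarrow>
    \<exists>c. arc c \<and> pathstart c = p (hd xs) \<and> pathfinish c = p (last xs) \<and>
        path_image c = (\<Union>e\<in>walk_edges xs. path_image (g e))"
proof (induction xs rule: walk_edges.induct)
  case (1 u v xs)
  let ?e = "{u, v}"
  have e: "?e \<in> E" using 1(2) by simp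
  with draw have ge: "arc (g ?e)" "{pathstart (g ?e), pathfinish (g ?e)} = {p u, p v}"
    unfolding plane_drawing_def by auto
  obtain d where d: "arc d" "pathstart d = p u" "pathfinish d = p v" "path_image d = path_image (g ?e)"
  proof (cases "pathstart (g ?e) = p u")
    case True
    with ge arc_distinct_ends[OF ge(1)] that[of "g ?e"] show ?thesis by (auto simp: doubleton_eq_iff)
  next
    case False
    with ge that[of "reversepath (g ?e)"] show ?thesis by (auto simp: doubleton_eq_iff arc_reversepath)
  qed
  show ?case
  proof (cases xs)
    case Nil
    with d show ?thesis by (intro exI[of _ d]) auto
  next
    case (Cons w ws)
    have w: "walk E (v # xs)" "distinct (v # xs)" "length (v # xs) \<ge> 2" "set (v # xs) \<subseteq> V"
      using 1 Cons by auto
    then obtain c where c: "arc c" "pathstart c = p v" "pathfinish c = p (last (v # xs))"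
      "path_image c = (\<Union>e\<in>walk_edges (v # xs). path_image (g e))"
      using 1(1) by auto
    have meet: "path_image (g ?e) \<inter> path_image (g f) \<subseteq> {p v}" if f: "f \<in> walk_edges (v # xs)" for f
    proof -
      have "u \<notin> f" using walk_edges_subset[OF f] 1(3) by auto
      moreover have "f \<in> E" using f w(1) by (auto simp: walk_iff_walk_edges)
      moreover from \<open>u \<notin> f\<close> have "?e \<noteq> f" by auto
      ultimately have "path_image (g ?e) \<inter> path_image (g f) \<subseteq> p ` (?e \<inter> f)"
        using draw e unfolding plane_drawing_def by blast
      with \<open>u \<notin> f\<close> show ?thesis by auto
    qed
    show ?thesis
    proof (intro exI[of _ "d +++ c"] conjI)
      have "path_image d \<inter> path_image c \<subseteq> {pathstart c}"
        using meet unfolding c d by blast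
      then show "arc (d +++ c)" using c d by (intro arc_join) auto
    qed (use c d in \<open>auto simp: path_image_join\<close>)
  qed
qed auto

text \<open>The three paths are drawn as arcs with common ends that meet nowhere else, and the first
  inner vertex of each path is a point of its arc on the outer face.\<close>

lemma outerplanar_imp_theta_free:
  assumes "outerplanar V E"
  shows "theta_free E"
  unfolding theta_free_def
proof (intro notI, elim exE conjE)
  fix a b X Y Z
  assume links: "link E a b X" "link E a b Y" "link E a b Z"
    and disj: "set X \<inter> set Y = {}" "set X \<inter> set Z = {}" "set Y \<inter> set Z = {}"
  from assms obtain p g where sg: "simple_graph V E" and draw: "plane_drawing V E p g"
    and front: "p ` V \<subseteq> frontier (outside (drawing_image V E p g))"
    unfolding outerplanar_def by blast
  define W where "W = (\<lambda>i::nat. if i = 0 then X else if i = 1 then Y else Z)"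
  define P where "P = (\<lambda>i. a # W i @ [b])"
  have W: "link E a b (W i)" for i using links by (auto simp: W_def)
  have Wdisj: "set (W i) \<inter> set (W j) = {}" if "i < 3" "j < 3" "i \<noteq> j" for i j
    using that disj by (auto simp: W_def numeral_3_eq_3 less_Suc_eq)
  have E: "walk_edges (P i) \<subseteq> E" for i
    using W[of i] unfolding link_def P_def walk_iff_walk_edges by blast
  have len: "length (P i) \<ge> 2" for i by (simp add: P_def)
  have V: "set (P i) \<subseteq> V" for i
  proof -
    have "\<Union>(walk_edges (P i)) \<subseteq> V" using E[of i] sg unfolding simple_graph_def by blast
    with Union_walk_edges[OF len] show ?thesis by metis
  qed
  have inj: "inj_on p V" using draw by (simp add: plane_drawing_def)
  have "\<forall>i. \<exists>c. arc c \<and> pathstart c = p a \<and> pathfinish c = p b \<and>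
      path_image c = (\<Union>e\<in>walk_edges (P i). path_image (g e))"
  proof
    fix i
    show "\<exists>c. arc c \<and> pathstart c = p a \<and> pathfinish c = p b \<and>
      path_image c = (\<Union>e\<in>walk_edges (P i). path_image (g e))"
      using walk_arc[OF draw _ _ len V, of i] W[of i] unfolding link_def P_def by auto
  qed
  then obtain c where c: "\<And>i. arc (c i)" "\<And>i. pathstart (c i) = p a" "\<And>i. pathfinish (c i) = p b"
    "\<And>i. path_image (c i) = (\<Union>e\<in>walk_edges (P i). path_image (g e))"
    by metis
  have vertex: "p ` set (P i) \<subseteq> path_image (c i)" for i
  proof
    fix z assume "z \<in> p ` set (P i)"
    then obtain v e where "z = p v" "e \<in> walk_edges (P i)" "v \<in> e"
      using Union_walk_edges[OF len[of i]] by blast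
    moreover from this have "p ` e \<subseteq> path_image (g e)"
      using draw E[of i] unfolding plane_drawing_def by blast
    ultimately show "z \<in> path_image (c i)" unfolding c(4) by blast
  qed
  let ?x = "\<lambda>i. p (hd (W i))"
  have hd: "hd (W i) \<in> set (W i)" for i using W[of i] by (simp add: link_def)
  show False
  proof (rule no_theta_on_outer_face[of c "p a" "p b" ?x "drawing_image V E p g"])
    fix i j :: nat
    assume ij: "i < 3" "j < 3" "i \<noteq> j"
    show "path_image (c i) \<inter> path_image (c j) = {p a, p b}"
    proof
      show "{p a, p b} \<subseteq> path_image (c i) \<inter> path_image (c j)"
        using vertex[of i] vertex[of j] by (auto simp: P_def)
      show "path_image (c i) \<inter> path_image (c j) \<subseteq> {p a, p b}"
      proof
        fix z assume "z \<in> path_image (c i) \<inter> path_image (c j)"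
        then obtain e f where ef: "e \<in> walk_edges (P i)" "f \<in> walk_edges (P j)"
          "z \<in> path_image (g e) \<inter> path_image (g f)" unfolding c(4) by blast
        have "e \<inter> set (W i) \<noteq> {}"
          using walk_edges_link_meets_inner[of a "W i" b e] ef(1) W[of i] by (simp add: link_def P_def)
        moreover have "f \<inter> set (W i) = {}"
          using walk_edges_subset[OF ef(2)] Wdisj[OF ij] W[of i] by (auto simp: P_def link_def)
        ultimately have "e \<noteq> f" by auto
        moreover have "e \<in> E" "f \<in> E" using E ef by blast+
        ultimately have "path_image (g e) \<inter> path_image (g f) \<subseteq> p ` (e \<inter> f)"
          using draw unfolding plane_drawing_def by blast
        with ef(3) have "z \<in> p ` (e \<inter> f)" by blast
        moreover have "e \<inter> f \<subseteq> {a, b}"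
          using walk_edges_subset[OF ef(1)] walk_edges_subset[OF ef(2)] Wdisj[OF ij]
          by (auto simp: P_def)
        ultimately show "z \<in> {p a, p b}" by blast
      qed
    qed
  next
    fix i :: nat
    show "arc (c i) \<and> pathstart (c i) = p a \<and> pathfinish (c i) = p b" using c by simp
    have "hd (W i) \<noteq> a" "hd (W i) \<noteq> b" using hd[of i] W[of i] by (auto simp: link_def)
    moreover have "{a, b, hd (W i)} \<subseteq> V" using V[of i] hd[of i] by (auto simp: P_def)
    ultimately have "?x i \<notin> {p a, p b}" using inj by (auto simp: inj_on_def)
    moreover have "?x i \<in> path_image (c i)" using vertex[of i] hd[of i] by (auto simp: P_def)
    moreover have "?x i \<in> closure (outside (drawing_image V E p g))"
      using front V[of i] hd[of i] by (auto simp: P_def frontier_def)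
    ultimately show "?x i \<in> path_image (c i) - {p a, p b} \<and>
        ?x i \<in> closure (outside (drawing_image V E p g))" by blast
    show "path_image (c i) \<subseteq> drawing_image V E p g"
      using E[of i] unfolding c(4) drawing_image_def by blast
  qed
qed

subsection \<open>Edge bound for graphs without thetas\<close>

lemma walk_rev: "walk E (rev xs) \<longleftrightarrow> walk E xs"
  by (simp add: insert_commute)

lemma link_rev: "link E a b X \<Longrightarrow> link E b a (rev X)"
  using walk_rev[of E "a # X @ [b]"] by (auto simp: link_def)

text \<open>Jump from position \<open>i\<close> to \<open>l\<close>, follow \<open>xs\<close> to
  \<open>m\<close> in either direction, and jump to \<open>j\<close>. All thetas below are assembled
  from such links along a longest path.\<close>

lemma link_segment:
  assumes path: "distinct xs" "walk E xs"
    and idx: "i < length xs" "j < length xs" "l < length xs" "m < length xs" "i \<noteq> j"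
      "i \<notin> {min l m..max l m}" "j \<notin> {min l m..max l m}"
    and ends: "{xs ! i, xs ! l} \<in> E" "{xs ! m, xs ! j} \<in> E"
  shows "\<exists>Z. link E (xs ! i) (xs ! j) Z \<and> set Z = (!) xs ` {min l m..max l m}"
proof -
  have main: "\<exists>Z. link E (xs ! i) (xs ! j) Z \<and> set Z = (!) xs ` {l..m}"
    if "l \<le> m" and idx: "i < length xs" "j < length xs" "m < length xs" "i \<noteq> j" "i \<notin> {l..m}" "j \<notin> {l..m}"
      and ends: "{xs ! i, xs ! l} \<in> E" "{xs ! m, xs ! j} \<in> E" for i j l m
  proof -
    define Z where "Z = take (Suc m - l) (drop l xs)"
    have Z: "Z \<noteq> []" "hd Z = xs ! l" "last Z = xs ! m"
      using that(1) idx by (auto simp: Z_def hd_drop_conv_nth last_conv_nth)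
    have set: "set Z = (!) xs ` {l..m}"
    proof -
      have "Z = map ((!) xs) [l..<Suc m]"
        using that(1) idx by (auto simp: Z_def simp del: upt_Suc intro!: nth_equalityI)
      then show ?thesis by (simp add: atLeastLessThanSuc_atLeastAtMost del: upt_Suc)
    qed
    have "distinct Z" using path by (simp add: Z_def)
    moreover have "xs ! i \<notin> set Z" "xs ! j \<notin> set Z" "xs ! i \<noteq> xs ! j"
      using idx path(1) unfolding set by (auto simp: nth_eq_iff_index_eq)
    moreover have "walk E Z"
      using path(2) append_take_drop_id[of l xs] append_take_drop_id[of "Suc m - l" "drop l xs"]
      unfolding Z_def by (metis successively_append_iff)
    ultimately have "link E (xs ! i) (xs ! j) Z"
      using Z ends by (auto simp: link_def successively_append_iff successively_Cons)
    with set show ?thesis by blast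
  qed
  show ?thesis
  proof (cases "l \<le> m")
    case True
    with main[of l m i j] assms show ?thesis by (auto simp: min_def max_def)
  next
    case False
    with main[of m l j i] assms obtain Z
      where "link E (xs ! j) (xs ! i) Z" "set Z = (!) xs ` {m..l}"
      by (auto simp: insert_commute min_def max_def)
    with False show ?thesis
      by (intro exI[of _ "rev Z"]) (auto simp: link_rev min_def max_def)
  qed
qed

text \<open>Reduces a theta with hubs at positions \<open>i\<close> and \<open>j\<close> to
  arithmetic: its three paths are given by disjoint stretches of positions, each entered at
  \<open>l\<close> and left at \<open>m\<close>.\<close>

lemma theta_free_segments:
  assumes "theta_free E" and path: "distinct xs" "walk E xs"
    and idx: "i < length xs" "j < length xs" "i \<noteq> j"
    and 1: "l1 < length xs" "m1 < length xs" "{xs ! i, xs ! l1} \<in> E" "{xs ! m1, xs ! j} \<in> E"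
      "i \<notin> {min l1 m1..max l1 m1}" "j \<notin> {min l1 m1..max l1 m1}"
    and 2: "l2 < length xs" "m2 < length xs" "{xs ! i, xs ! l2} \<in> E" "{xs ! m2, xs ! j} \<in> E"
      "i \<notin> {min l2 m2..max l2 m2}" "j \<notin> {min l2 m2..max l2 m2}"
    and 3: "l3 < length xs" "m3 < length xs" "{xs ! i, xs ! l3} \<in> E" "{xs ! m3, xs ! j} \<in> E"
      "i \<notin> {min l3 m3..max l3 m3}" "j \<notin> {min l3 m3..max l3 m3}"
    and disj: "{min l1 m1..max l1 m1} \<inter> {min l2 m2..max l2 m2} = {}"
      "{min l1 m1..max l1 m1} \<inter> {min l3 m3..max l3 m3} = {}"
      "{min l2 m2..max l2 m2} \<inter> {min l3 m3..max l3 m3} = {}"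
  shows False
proof -
  note L = link_segment[OF path idx(1,2)]
  obtain X Y Z where links: "link E (xs ! i) (xs ! j) X" "link E (xs ! i) (xs ! j) Y" "link E (xs ! i) (xs ! j) Z"
    and sets: "set X = (!) xs ` {min l1 m1..max l1 m1}" "set Y = (!) xs ` {min l2 m2..max l2 m2}"
      "set Z = (!) xs ` {min l3 m3..max l3 m3}"
    using L[OF 1(1,2) idx(3) 1(5,6,3,4)] L[OF 2(1,2) idx(3) 2(5,6,3,4)] L[OF 3(1,2) idx(3) 3(5,6,3,4)]
    by blast
  have inj: "(!) xs ` A \<inter> (!) xs ` B = {}" if "A \<inter> B = {}" "A \<subseteq> {..<length xs}" "B \<subseteq> {..<length xs}" for A B
    using that inj_on_image_Int[OF inj_on_nth[OF path(1)], of "{..<length xs}" A B] by simp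
  have "{min l1 m1..max l1 m1} \<subseteq> {..<length xs}" "{min l2 m2..max l2 m2} \<subseteq> {..<length xs}"
    "{min l3 m3..max l3 m3} \<subseteq> {..<length xs}"
    using 1(1,2) 2(1,2) 3(1,2) by auto
  then have "set X \<inter> set Y = {}" "set X \<inter> set Z = {}" "set Y \<inter> set Z = {}"
    unfolding sets using inj disj by blast+
  with links assms(1) show False unfolding theta_free_def by blast
qed

text \<open>The case of the induction for the edge bound in which no vertex of degree at most 2 can
  be deleted. The aim is a \<open>K_4\<close> attached to the rest at one vertex.\<close>

locale theta_free_min_degree_3 =
  fixes V :: "'a set" and E :: "'a set set"
  assumes simple: "simple_graph V E" and theta: "theta_free E"
    and degree: "\<And>v. v \<in> V \<Longrightarrow> card {u. {v, u} \<in> E} \<ge> 3"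
begin

definition path :: "'a list \<Rightarrow> bool" where
  "path xs \<longleftrightarrow> distinct xs \<and> walk E xs \<and> set xs \<subseteq> V"

definition longest :: "'a list \<Rightarrow> bool" where
  "longest xs \<longleftrightarrow> xs \<noteq> [] \<and> path xs \<and> (\<forall>ys. path ys \<longrightarrow> length ys \<le> length xs)"

lemma edge: "{u, v} \<in> E \<Longrightarrow> u \<in> V \<and> v \<in> V \<and> u \<noteq> v"
  using simple by (force simp: simple_graph_def)

lemma longest_exists:
  assumes "V \<noteq> {}"
  shows "\<exists>xs. longest xs"
proof -
  obtain v where "v \<in> V" using assms by blast
  then have v: "path [v]" by (simp add: path_def)
  have fin: "finite V" using simple by (simp add: simple_graph_def)
  have "length ys < Suc (card V)" if "path ys" for ys
    using that fin by (metis card_mono distinct_card less_Suc_eq_le path_def)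
  then obtain xs where "path xs" "\<forall>ys. path ys \<longrightarrow> length ys \<le> length xs"
    using ex_has_greatest_nat[of path, OF v] by (metis less_imp_le)
  moreover from this v have "xs \<noteq> []" by fastforce
  ultimately show ?thesis unfolding longest_def by blast
qed

lemma longest_neighbour:
  assumes "longest xs" "{xs ! 0, u} \<in> E"
  obtains k where "0 < k" "k < length xs" "xs ! k = u"
proof -
  have "u \<in> set xs"
  proof (rule ccontr)
    assume "u \<notin> set xs"
    with assms have "path (u # xs)"
      using edge[OF assms(2)] by (auto simp: longest_def path_def successively_Cons hd_conv_nth insert_commute)
    with assms(1) show False unfolding longest_def by fastforce
  qed
  then obtain k where "k < length xs" "xs ! k = u" by (auto simp: in_set_conv_nth)
  moreover have "k \<noteq> 0" using edge[OF assms(2)] calculation by (metis)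
  ultimately show ?thesis using that by simp
qed

text \<open>At least three neighbours cannot all sit at the two positions 1 and \<open>i\<close>.
  The free choice of \<open>i\<close> serves to exclude a neighbour that is already known.\<close>

lemma longest_third_neighbour:
  assumes "longest xs"
  obtains k where "2 \<le> k" "k < length xs" "k \<noteq> i" "{xs ! 0, xs ! k} \<in> E"
proof -
  let ?N = "{u. {xs ! 0, u} \<in> E}"
  have "xs ! 0 \<in> V" using assms by (auto simp: longest_def path_def)
  then have "card ?N \<ge> 3" by (rule degree)
  moreover have "card {xs ! 1, xs ! i} \<le> 2"
    by (simp add: card_insert_if)
  ultimately have "\<not> ?N \<subseteq> {xs ! 1, xs ! i}"
    using card_mono[of "{xs ! 1, xs ! i}" ?N] by fastforce
  then obtain u where u: "{xs ! 0, u} \<in> E" "u \<noteq> xs ! 1" "u \<noteq> xs ! i" by blast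
  obtain k where "0 < k" "k < length xs" "xs ! k = u" using longest_neighbour[OF assms u(1)] .
  with u that[of k] show ?thesis by (cases "k = 1") auto
qed

text \<open>Posa rotation: an edge from the start to position \<open>i\<close> lets the initial
  segment before \<open>i\<close> be reversed, so that \<open>xs ! (i - 1)\<close> becomes the start
  of another longest path.\<close>

lemma longest_rotate:
  assumes "longest xs" "1 \<le> i" "i < length xs" "{xs ! 0, xs ! i} \<in> E"
  defines "ys \<equiv> rev (take i xs) @ drop i xs"
  shows "longest ys" "length ys = length xs"
    "\<And>k. k < i \<Longrightarrow> ys ! k = xs ! (i - 1 - k)" "\<And>k. i \<le> k \<Longrightarrow> k < length xs \<Longrightarrow> ys ! k = xs ! k"
proof -
  show len: "length ys = length xs" using assms by simp
  have "distinct (take i xs @ drop i xs)" "walk E (take i xs @ drop i xs)"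
    using assms(1) unfolding append_take_drop_id longest_def path_def by auto
  moreover have "last (rev (take i xs)) = xs ! 0" "hd (drop i xs) = xs ! i"
    using assms(2,3) by (cases xs; auto simp: hd_drop_conv_nth last_rev)+
  ultimately have "distinct ys" "walk E ys"
    using assms(4) unfolding ys_def
    by (simp_all add: successively_append_iff insert_commute del: append_take_drop_id)
  moreover have "set ys = set xs"
    unfolding ys_def by (metis append_take_drop_id set_append set_rev)
  ultimately show "longest ys" using assms(1) len unfolding longest_def path_def by auto
  show "\<And>k. k < i \<Longrightarrow> ys ! k = xs ! (i - 1 - k)"
    using assms(3) by (auto simp: ys_def nth_append rev_nth min_def)
  show "\<And>k. i \<le> k \<Longrightarrow> k < length xs \<Longrightarrow> ys ! k = xs ! k"
    using assms(3) by (auto simp: ys_def nth_append)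
qed

lemma longest_consecutive:
  assumes "longest xs" "Suc k < length xs"
  shows "{xs ! k, xs ! Suc k} \<in> E" "{xs ! Suc k, xs ! k} \<in> E"
proof -
  have "walk E (take k xs @ drop k xs)" using assms(1) by (simp add: longest_def path_def)
  then have "walk E (drop k xs)" unfolding successively_append_iff by blast
  also have "drop k xs = xs ! k # xs ! Suc k # drop (Suc (Suc k)) xs"
    using assms(2) by (metis Cons_nth_drop_Suc Suc_lessD)
  finally show "{xs ! k, xs ! Suc k} \<in> E" "{xs ! Suc k, xs ! k} \<in> E"
    by (simp_all add: insert_commute)
qed

text \<open>Rotating a longest path on whose start the least neighbour position \<open>i \<ge> 2\<close> is minimal gives a
  second longest path with start \<open>xs ! (i - 1)\<close> that has a neighbour beyond \<open>i\<close> as well. Unless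
  \<open>i = 2\<close>, this yields a theta.\<close>
lemma longest_with_triangle:
  assumes "V \<noteq> {}"
  obtains xs where "longest xs" "{xs ! 0, xs ! 2} \<in> E"
proof -
  define Q where "Q = (\<lambda>i. \<exists>xs. longest xs \<and> 2 \<le> i \<and> i < length xs \<and> {xs ! 0, xs ! i} \<in> E)"
  define i where "i = (LEAST i. Q i)"
  obtain xs0 where xs0: "longest xs0" using longest_exists[OF assms] by blast
  obtain k0 where "2 \<le> k0" "k0 < length xs0" "{xs0 ! 0, xs0 ! k0} \<in> E"
    using longest_third_neighbour[OF xs0, of 0] by blast
  with xs0 have "Q k0" by (auto simp: Q_def)
  then have "Q i" and least: "\<And>k. Q k \<Longrightarrow> i \<le> k" unfolding i_def by (auto intro: LeastI Least_le)
  then obtain xs where xs: "longest xs" and i: "2 \<le> i" "i < length xs" and e: "{xs ! 0, xs ! i} \<in> E"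
    by (auto simp: Q_def)
  \<comment> \<open>\<open>i\<close> is least over all longest paths, and a third neighbour can be
    chosen at a position other than \<open>i\<close>; it then lies beyond \<open>i\<close>.\<close>
  have far: "\<exists>l. i < l \<and> l < length ys \<and> {ys ! 0, ys ! l} \<in> E" if "longest ys" for ys
  proof -
    obtain l where l: "2 \<le> l" "l < length ys" "l \<noteq> i" "{ys ! 0, ys ! l} \<in> E"
      using longest_third_neighbour[OF \<open>longest ys\<close>, of i] by blast
    with that have "Q l" by (auto simp: Q_def)
    from least[OF this] l show ?thesis by (intro exI[of _ l]) auto
  qed
  obtain l where l: "i < l" "l < length xs" "{xs ! 0, xs ! l} \<in> E" using far[OF xs] by blast
  have "1 \<le> i" using i by simp
  note rot = longest_rotate[OF xs this i(2) e]
  obtain m where m: "i < m" "m < length xs" "{xs ! (i - 1), xs ! m} \<in> E"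
    using far[OF rot(1)] rot(2) rot(3)[of 0] rot(4) i by fastforce
  have "i = 2"
  proof (rule ccontr)
    assume "i \<noteq> 2"
    with i have i3: "3 \<le> i" by simp
    \<comment> \<open>The hubs are \<open>xs ! 0\<close> and \<open>xs ! (i - 1)\<close>. The paths
      run through the positions from 1 to \<open>i - 2\<close>, through \<open>i\<close> alone, and
      through those between \<open>l\<close> and \<open>m\<close>; the first stretch needs
      \<open>3 \<le> i\<close>.\<close>
    show False
    proof (rule theta_free_segments[OF theta, of xs 0 "i - 1" 1 "i - 2" i i l m])
      show "distinct xs" "walk E xs" using xs by (auto simp: longest_def path_def)
      show "{xs ! 0, xs ! 1} \<in> E" using longest_consecutive(1)[OF xs, of 0] i by simp
      have "Suc (i - 2) = i - 1" using i3 by simp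
      then show "{xs ! (i - 2), xs ! (i - 1)} \<in> E"
        using longest_consecutive(1)[OF xs, of "i - 2"] i by simp
      show "{xs ! i, xs ! (i - 1)} \<in> E"
        using longest_consecutive(2)[OF xs, of "i - 1"] i by simp
      show "{xs ! m, xs ! (i - 1)} \<in> E" using m by (simp add: insert_commute)
    qed (use i i3 l m e in auto)
  qed
  with xs e that show ?thesis by blast
qed

text \<open>For \<open>l < m\<close>, the hubs at \<open>l\<close> and 1 are joined through
  \<open>l + 1\<close> up to \<open>m\<close>, through 0, and through \<open>l - 1\<close> down to
  2. The case \<open>m < l\<close> is the same with 0 and 1 exchanged. If \<open>l = m > 3\<close>,
  the hubs at 2 and \<open>l\<close> are joined through 3 up to \<open>l - 1\<close>, through 0, and
  through 1.\<close>

lemma triangle_crossing: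
  assumes xs: "longest xs" and tri: "{xs ! 0, xs ! 2} \<in> E"
    and l: "3 \<le> l" "l < length xs" "{xs ! 0, xs ! l} \<in> E"
    and m: "3 \<le> m" "m < length xs" "{xs ! 1, xs ! m} \<in> E"
  shows "l = 3 \<and> m = 3"
proof -
  have p: "distinct xs" "walk E xs" using xs by (auto simp: longest_def path_def)
  note con = longest_consecutive[OF xs]
  have e01: "{xs ! 0, xs ! 1} \<in> E" "{xs ! 1, xs ! 0} \<in> E" using con[of 0] l by auto
  have e12: "{xs ! 1, xs ! 2} \<in> E" "{xs ! 2, xs ! 1} \<in> E" using con[of 1] l by (auto simp: numeral_2_eq_2)
  have e23: "{xs ! 2, xs ! 3} \<in> E" using con[of 2] l by (auto simp: numeral_3_eq_3)
  have bwd: "{xs ! l, xs ! 0} \<in> E" "{xs ! m, xs ! 1} \<in> E" "{xs ! 2, xs ! 0} \<in> E"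
    using l m tri by (simp_all add: insert_commute)
  have up: "{xs ! k, xs ! (k + 1)} \<in> E" if "k + 1 < length xs" for k using con that by simp
  have down: "{xs ! k, xs ! (k - 1)} \<in> E" if "3 \<le> k" "k < length xs" for k using con(2)[of "k - 1"] that by simp
  consider "l < m" | "m < l" | "l = m" "3 < l" | "l = m" "l = 3" using l by linarith
  then show ?thesis
  proof cases
    case 1
    have False
      by (rule theta_free_segments[OF theta p, of l 1 "l + 1" m 0 0 "l - 1" 2])
        (use 1 l m e01 e12 bwd up down in auto)
    then show ?thesis ..
  next
    case 2
    have False
      by (rule theta_free_segments[OF theta p, of m 0 "m + 1" l 1 1 "m - 1" 2])
        (use 2 l m e01 e12 bwd up down in auto)
    then show ?thesis ..
  next
    case 3
    have False
    proof (rule theta_free_segments[OF theta p, of 2 l 3 "l - 1" 0 0 1 1])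
      show "{xs ! (l - 1), xs ! l} \<in> E" using up[of "l - 1"] 3 l by simp
    qed (use 3 l m e01 e12 e23 bwd in auto)
    then show ?thesis ..
  qed simp
qed

text \<open>Rotating at the triangle exchanges the first two vertices, so both are starts of longest
  paths. Their neighbours at positions beyond 2 are then confined to 3 by
  \<open>triangle_crossing\<close>, and the degree bound turns the inclusions into
  equalities.\<close>

lemma triangle_neighbours:
  assumes xs: "longest xs" and tri: "{xs ! 0, xs ! 2} \<in> E"
  shows "3 < length xs" "{u. {xs ! 0, u} \<in> E} = {xs ! 1, xs ! 2, xs ! 3}"
    "{u. {xs ! 1, u} \<in> E} = {xs ! 0, xs ! 2, xs ! 3}"
proof -
  obtain l where l: "2 \<le> l" "l < length xs" "l \<noteq> 2" "{xs ! 0, xs ! l} \<in> E"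
    using longest_third_neighbour[OF xs, of 2] by blast
  then have l3: "3 \<le> l" by simp
  with l show len: "3 < length xs"
  proof -
    have 2: "1 \<le> (2::nat)" "2 < length xs" using l by auto
    note rot = longest_rotate[OF xs 2 tri]
    obtain m where "2 \<le> m" "m < length xs" "m \<noteq> 2" "{xs ! 1, xs ! m} \<in> E"
      using longest_third_neighbour[OF rot(1), of 2] rot(2) rot(3)[of 0] rot(4)
      by (metis diff_zero one_le_numeral order_less_le_trans add_diff_cancel_right' one_add_one zero_less_numeral)
    with triangle_crossing[OF xs tri l3 l(2,4), of m] l show ?thesis by auto
  qed
  have 2: "1 \<le> (2::nat)" "2 < length xs" using len by auto
  define ys where "ys = rev (take 2 xs) @ drop 2 xs"
  note rot = longest_rotate[OF xs 2 tri, folded ys_def]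
  have ys: "ys ! 0 = xs ! 1" "ys ! 1 = xs ! 0" "\<And>k. 2 \<le> k \<Longrightarrow> k < length xs \<Longrightarrow> ys ! k = xs ! k"
    using rot(3)[of 0] rot(3)[of 1] rot(4) by auto
  obtain m where m: "2 \<le> m" "m < length xs" "m \<noteq> 2" "{xs ! 1, xs ! m} \<in> E"
    using longest_third_neighbour[OF rot(1), of 2] rot(2) ys by metis
  then have m3: "3 \<le> m" by simp
  have sub0: "{u. {xs ! 0, u} \<in> E} \<subseteq> {xs ! 1, xs ! 2, xs ! 3}"
  proof
    fix u assume u: "u \<in> {u. {xs ! 0, u} \<in> E}"
    then obtain k where k: "0 < k" "k < length xs" "xs ! k = u"
      using longest_neighbour[OF xs, of u] by blast
    have "k = 3" if "3 \<le> k"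
      using triangle_crossing[OF xs tri that k(2) _ m3 m(2,4)] k u by simp
    then have "k \<in> {1, 2, 3}" using k(1) by force
    with k show "u \<in> {xs ! 1, xs ! 2, xs ! 3}" by auto
  qed
  have sub1: "{u. {xs ! 1, u} \<in> E} \<subseteq> {xs ! 0, xs ! 2, xs ! 3}"
  proof
    fix u assume u: "u \<in> {u. {xs ! 1, u} \<in> E}"
    then obtain k where k: "0 < k" "k < length xs" "ys ! k = u"
      using longest_neighbour[OF rot(1), of u] ys rot(2) by auto
    have "k = 3" if "3 \<le> k"
      using triangle_crossing[OF xs tri l3 l(2,4) that k(2)] k u ys(3)[of k] that by simp
    then have "k \<in> {1, 2, 3}" using k(1) by force
    with k ys len show "u \<in> {xs ! 0, xs ! 2, xs ! 3}" by auto
  qed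
  have V: "xs ! 0 \<in> V" "xs ! 1 \<in> V"
    using xs len by (auto simp: longest_def path_def subset_iff)
  have eq: "A = {a, b, c}" if "A \<subseteq> {a, b, c}" "card A \<ge> 3" for A and a b c :: 'a
  proof (rule card_seteq[OF _ that(1)])
    have "card {a, b, c} \<le> 3" by (simp add: card_insert_if)
    with that(2) show "card {a, b, c} \<le> card A" by simp
  qed simp
  show "{u. {xs ! 0, u} \<in> E} = {xs ! 1, xs ! 2, xs ! 3}" by (rule eq[OF sub0 degree[OF V(1)]])
  show "{u. {xs ! 1, u} \<in> E} = {xs ! 0, xs ! 2, xs ! 3}" by (rule eq[OF sub1 degree[OF V(2)]])
qed

text \<open>A rotation at the edge from position 0 to position 3 makes \<open>xs ! 2\<close> a start
  as well, again with a triangle, so the previous lemma also determines its neighbours. Only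
  \<open>d\<close> may have neighbours outside the \<open>K_4\<close>.\<close>

lemma pendant_K4:
  assumes "V \<noteq> {}"
  obtains a b c d where "distinct [a, b, c, d]" "{a, b, c, d} \<subseteq> V"
    "{u. {a, u} \<in> E} = {b, c, d}" "{u. {b, u} \<in> E} = {a, c, d}" "{u. {c, u} \<in> E} = {a, b, d}"
proof -
  obtain xs where xs: "longest xs" and tri: "{xs ! 0, xs ! 2} \<in> E"
    using longest_with_triangle[OF assms] .
  note N = triangle_neighbours[OF xs tri]
  have e: "{xs ! 0, xs ! 3} \<in> E" using N(2) by blast
  define zs where "zs = rev (take 3 xs) @ drop 3 xs"
  note rot = longest_rotate[OF xs _ N(1) e, folded zs_def]
  have zs: "longest zs" "zs ! 0 = xs ! 2" "zs ! 1 = xs ! 1" "zs ! 2 = xs ! 0" "zs ! 3 = xs ! 3"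
    using rot(1) rot(3)[of 0] rot(3)[of 1] rot(3)[of 2] rot(4)[of 3] N(1) by auto
  have "{zs ! 0, zs ! 2} \<in> E" using tri zs by (simp add: insert_commute)
  from triangle_neighbours(2)[OF zs(1) this]
  have "{u. {xs ! 2, u} \<in> E} = {xs ! 0, xs ! 1, xs ! 3}" using zs by auto
  moreover have "distinct [xs ! 0, xs ! 1, xs ! 2, xs ! 3]" "{xs ! 0, xs ! 1, xs ! 2, xs ! 3} \<subseteq> V"
    using xs N(1) by (auto simp: longest_def path_def nth_eq_iff_index_eq subset_iff)
  ultimately show ?thesis using that[of "xs ! 0" "xs ! 1" "xs ! 2" "xs ! 3"] N by simp
qed

end

section \<open>The induction for the edge bound\<close>

lemma link_mono: "link F a b X \<Longrightarrow> F \<subseteq> E \<Longrightarrow> link E a b X"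
  by (auto simp: link_def walk_iff_walk_edges)

lemma theta_free_mono: "theta_free E \<Longrightarrow> F \<subseteq> E \<Longrightarrow> theta_free F"
  unfolding theta_free_def by (meson link_mono)

lemma simple_graph_Diff: "simple_graph V E \<Longrightarrow> simple_graph (V - T) {e \<in> E. e \<inter> T = {}}"
  by (auto simp: simple_graph_def)

lemma simple_graph_finite_edges: "simple_graph V E \<Longrightarrow> finite E"
  unfolding simple_graph_def by (auto intro: finite_subset[of _ "Pow V"])

lemma simple_graph_edgeE:
  assumes "simple_graph V E" "e \<in> E"
  obtains u v where "e = {u, v}" "u \<noteq> v" "u \<in> V" "v \<in> V"
proof -
  have "e \<subseteq> V" "card e = 2" using assms unfolding simple_graph_def by auto
  then show ?thesis using that unfolding card_2_iff by auto
qed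

lemma simple_graph_edge_at:
  assumes "simple_graph V E" "e \<in> E" "v \<in> e"
  obtains u where "e = {v, u}"
  using simple_graph_edgeE[OF assms(1,2)] assms(3) by (metis insert_commute insertE singletonD)

text \<open>Each deletion removes at most twice as many edges as vertices: one vertex with at most 2
  edges, or the vertices \<open>a\<close>, \<open>b\<close>, \<open>c\<close> of a
  \<open>K_4\<close> with at most 6.\<close>

lemma theta_free_edge_bound:
  assumes "simple_graph V E" "theta_free E" "V \<noteq> {}"
  shows "card E \<le> 2 * card V - 2"
  using assms
proof (induction "card V" arbitrary: V E rule: less_induct)
  case less
  note sg = less.prems(1)
  have fin: "finite V" "finite E"
    using sg simple_graph_finite_edges by (auto simp: simple_graph_def)
  \<comment> \<open>\<open>T\<close> is the set of deleted vertices and \<open>F\<close> any finite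
    set covering the edges at \<open>T\<close>. Some vertex must survive, as the bound fails to be
    \<open>2 * card V - 2\<close> as an integer for the empty graph.\<close>
  have IH: "card E \<le> card F + (2 * (card V - card T) - 2)"
    if "T \<subseteq> V" "T \<noteq> {}" "T \<noteq> V" "{e \<in> E. e \<inter> T \<noteq> {}} \<subseteq> F" "finite F" for T F
  proof -
    let ?E = "{e \<in> E. e \<inter> T = {}}"
    have card: "card (V - T) = card V - card T" using that fin by (simp add: card_Diff_subset finite_subset)
    have "card (V - T) < card V" using that fin by (intro psubset_card_mono) auto
    then have "card ?E \<le> 2 * card (V - T) - 2"
      using less.hyps[OF _ simple_graph_Diff[OF sg] theta_free_mono[OF less.prems(2)]] that by blast
    moreover have "E \<subseteq> ?E \<union> F" using that by blast
    then have "card E \<le> card (?E \<union> F)" using fin that by (intro card_mono) auto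
    then have "card E \<le> card ?E + card F" using card_Un_le le_trans by blast
    ultimately show ?thesis using card by simp
  qed
  show ?case
  proof (cases "\<exists>v\<in>V. card {u. {v, u} \<in> E} \<le> 2")
    case True
    then obtain v where v: "v \<in> V" "card {u. {v, u} \<in> E} \<le> 2" by blast
    show ?thesis
    proof (cases "V = {v}")
      case True
      then have "E = {}" using simple_graph_edgeE[OF sg] by (metis equals0I singletonD)
      then show ?thesis by simp
    next
      case False
      let ?F = "(\<lambda>u. {v, u}) ` {u. {v, u} \<in> E}"
      have nfin: "finite {u. {v, u} \<in> E}"
      proof (rule finite_subset[OF _ fin(1)])
        have "E \<subseteq> Pow V" using sg unfolding simple_graph_def by blast
        then show "{u. {v, u} \<in> E} \<subseteq> V" by blast
      qed
      have "card E \<le> card ?F + (2 * (card V - card {v}) - 2)"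
      proof (rule IH)
        show "{e \<in> E. e \<inter> {v} \<noteq> {}} \<subseteq> ?F"
        proof
          fix e assume "e \<in> {e \<in> E. e \<inter> {v} \<noteq> {}}"
          then obtain u where "e = {v, u}" "e \<in> E"
            using simple_graph_edge_at[OF sg, of e v] by blast
          then show "e \<in> ?F" by blast
        qed
      qed (use v False nfin in auto)
      moreover have "card ?F \<le> 2" using card_image_le[OF nfin] v(2) by (rule le_trans)
      moreover have "card V \<ge> 2"
      proof -
        have "{v} \<subset> V" using v(1) False by blast
        from psubset_card_mono[OF fin(1) this] show ?thesis by simp
      qed
      ultimately show ?thesis by simp
    qed
  next
    case False
    then interpret theta_free_min_degree_3 V E
      using less.prems by unfold_locales auto
    obtain a b c d where d: "distinct [a, b, c, d]" "{a, b, c, d} \<subseteq> V"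
      and N: "{u. {a, u} \<in> E} = {b, c, d}" "{u. {b, u} \<in> E} = {a, c, d}" "{u. {c, u} \<in> E} = {a, b, d}"
      using pendant_K4[OF less.prems(3)] .
    let ?F = "{{a, b}, {a, c}, {a, d}, {b, c}, {b, d}, {c, d}}"
    have "card E \<le> card ?F + (2 * (card V - card {a, b, c}) - 2)"
    proof (rule IH)
      show "{e \<in> E. e \<inter> {a, b, c} \<noteq> {}} \<subseteq> ?F"
      proof
        fix e assume "e \<in> {e \<in> E. e \<inter> {a, b, c} \<noteq> {}}"
        then obtain w where "w \<in> {a, b, c}" "w \<in> e" "e \<in> E" by blast
        then obtain u where e: "e = {w, u}" and w: "w \<in> {a, b, c}" and u: "u \<in> {u. {w, u} \<in> E}"
          using simple_graph_edge_at[OF sg, of e w] by blast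
        have "w = a \<and> u \<in> {b, c, d} \<or> w = b \<and> u \<in> {a, c, d} \<or> w = c \<and> u \<in> {a, b, d}"
          using w u N by (metis insertE singletonD)
        then show "e \<in> ?F" unfolding e by (elim disjE conjE insertE) (simp_all add: doubleton_eq_iff)
      qed
      have "d \<notin> {a, b, c}" "{a, b, c, d} \<subseteq> V" using d by auto
      then show "{a, b, c} \<subseteq> V" "{a, b, c} \<noteq> V" by blast+
    qed simp_all
    moreover have "card {a, b, c} = 3" using d by auto
    moreover have "card ?F \<le> 6" by (simp add: card_insert_if)
    moreover have "card V \<ge> 4" using card_mono[OF fin(1) d(2)] d(1) by auto
    ultimately show ?thesis by simp
  qed
qed

subsection \<open>Drawings on a parabola\<close>

text \<open>One interleaving pattern suffices: the ends of each edge appear in both orders, and the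
  two edges may be exchanged. The order by \<open>f\<close> is a book embedding in one page.\<close>

definition noncrossing :: "('a \<Rightarrow> real) \<Rightarrow> 'a set set \<Rightarrow> bool" where
  "noncrossing f E \<longleftrightarrow> (\<forall>a b c d. {a, b} \<in> E \<longrightarrow> {c, d} \<in> E \<longrightarrow> \<not> (f a < f c \<and> f c < f b \<and> f b < f d))"

text \<open>Points of a parabola are in convex position: all chords stay in the epigraph, while the
  region below belongs to the outer face.\<close>

definition parabola :: "real \<Rightarrow> complex" where
  "parabola x = Complex x (x\<^sup>2)"

lemma parabola_eq_iff [simp]: "parabola x = parabola y \<longleftrightarrow> x = y"
  by (auto simp: parabola_def)

text \<open>The height of a chord above the parabola factors through the distances to its ends, so
  chords can be compared by comparing products.\<close>

lemma chord_height:
  assumes "a < b" "z \<in> closed_segment (parabola a) (parabola b)"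
  shows "a \<le> Re z" "Re z \<le> b" "Im z - (Re z)\<^sup>2 = (Re z - a) * (b - Re z)"
proof -
  obtain u where u: "0 \<le> u" "u \<le> 1" and z: "z = (1 - u) *\<^sub>R parabola a + u *\<^sub>R parabola b"
    using assms(2) by (auto simp: in_segment)
  have re: "Re z = a + u * (b - a)" and im: "Im z = (1 - u) * a\<^sup>2 + u * b\<^sup>2"
    by (simp_all add: z parabola_def algebra_simps)
  show "a \<le> Re z" using u assms(1) by (simp add: re)
  have "u * (b - a) \<le> 1 * (b - a)" using u assms(1) by (intro mult_right_mono) auto
  then show "Re z \<le> b" by (simp add: re)
  show "Im z - (Re z)\<^sup>2 = (Re z - a) * (b - Re z)"
    unfolding re im by (simp add: power2_eq_square algebra_simps)
qed

text \<open>The intervals below two chords that do not cross either share at most an end or are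
  nested. In the nested case, the chord over the larger interval is higher except at common
  ends.\<close>

lemma chords_meet_at_ends:
  assumes "a < b" "c < d" "(a, b) \<noteq> (c, d)"
    and no: "\<not> (a < c \<and> c < b \<and> b < d)" "\<not> (c < a \<and> a < d \<and> d < b)"
    and z: "z \<in> closed_segment (parabola a) (parabola b)" "z \<in> closed_segment (parabola c) (parabola d)"
  shows "z \<in> parabola ` ({a, b} \<inter> {c, d})"
proof -
  define x where "x = Re z"
  note 1 = chord_height[OF assms(1) z(1), folded x_def]
  note 2 = chord_height[OF assms(2) z(2), folded x_def]
  have eq: "(x - a) * (b - x) = (x - c) * (d - x)" using 1 2 by simp
  \<comment> \<open>The difference of the two heights is a sum of two nonnegative products; at a
    common point both vanish, which forces \<open>x\<close> to be a common end.\<close>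
  have strict: "x \<in> {a', b'} \<inter> {c', d'}"
    if "a' \<le> c'" "d' \<le> b'" "(a', b') \<noteq> (c', d')" "c' \<le> x" "x \<le> d'"
      and eq: "(x - a') * (b' - x) = (x - c') * (d' - x)" for a' b' c' d'
  proof -
    have "(x - a') * (b' - x) - (x - c') * (d' - x) = (c' - a') * (b' - x) + (x - c') * (b' - d')"
      by (simp add: algebra_simps)
    moreover have "0 \<le> (c' - a') * (b' - x)" "0 \<le> (x - c') * (b' - d')" using that by auto
    ultimately have "(c' - a') * (b' - x) = 0" "(x - c') * (b' - d') = 0" using eq by linarith+
    with that show ?thesis by auto
  qed
  have x: "x \<in> {a, b} \<inter> {c, d}"
  proof -
    consider "b \<le> c" | "d \<le> a" | "a \<le> c" "d \<le> b" | "c \<le> a" "b \<le> d"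
      using no by linarith
    then show ?thesis
    proof cases
      case 3
      then show ?thesis using strict[of a c d b] 2 eq assms by blast
    next
      case 4
      then have "x \<in> {c, d} \<inter> {a, b}" using strict[of c a b d] 1 eq assms by auto
      then show ?thesis by blast
    qed (use 1 2 in auto)
  qed
  then have "(x - a) * (b - x) = 0" by auto
  then have "Im z = x\<^sup>2" using 1(3) by linarith
  then have "z = parabola x" by (simp add: complex_eq_iff x_def parabola_def)
  with x show ?thesis by blast
qed

lemma vertex_on_chord:
  assumes "a < b" "parabola x \<in> closed_segment (parabola a) (parabola b)"
  shows "x = a \<or> x = b"
  using chord_height(3)[OF assms] by (auto simp: parabola_def)

lemma convex_epigraph_parabola: "convex {z. (Re z)\<^sup>2 \<le> Im z}"
proof (rule convexI)
  fix w z :: complex and u v :: real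
  assume w: "w \<in> {z. (Re z)\<^sup>2 \<le> Im z}" "z \<in> {z. (Re z)\<^sup>2 \<le> Im z}"
    and uv: "0 \<le> u" "0 \<le> v" "u + v = 1"
  have v: "v = 1 - u" using uv by simp
  have "u * (Re w)\<^sup>2 + v * (Re z)\<^sup>2 - (u * Re w + v * Re z)\<^sup>2 = u * v * (Re w - Re z)\<^sup>2"
    unfolding v by (simp add: power2_eq_square algebra_simps)
  moreover have "0 \<le> u * v * (Re w - Re z)\<^sup>2" using uv by simp
  moreover have "u * (Re w)\<^sup>2 + v * (Re z)\<^sup>2 \<le> u * Im w + v * Im z"
    using w uv by (intro add_mono mult_left_mono) auto
  ultimately show "u *\<^sub>R w + v *\<^sub>R z \<in> {z. (Re z)\<^sup>2 \<le> Im z}" by simp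
qed

text \<open>The complement of the convex epigraph lies in \<open>outside S\<close>, and it contains
  points vertically below \<open>parabola x\<close> at arbitrarily small distance.\<close>

lemma parabola_frontier_outside:
  assumes S: "S \<subseteq> {z. (Re z)\<^sup>2 \<le> Im z}" and x: "parabola x \<in> S"
  shows "parabola x \<in> frontier (outside S)"
proof -
  have sub: "- {z. (Re z)\<^sup>2 \<le> Im z} \<subseteq> outside S"
    using outside_subset_convex[OF convex_epigraph_parabola S] .
  have "parabola x \<in> closure (outside S)"
  proof (rule closure_approachable[THEN iffD2], intro allI impI)
    fix e :: real assume "0 < e"
    let ?y = "Complex x (x\<^sup>2 - e / 2)"
    have "?y \<in> outside S" using sub \<open>0 < e\<close> by auto
    moreover have "dist ?y (parabola x) < e"
      using \<open>0 < e\<close> by (simp add: parabola_def dist_norm complex_diff complex_norm)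
    ultimately show "\<exists>y\<in>outside S. dist y (parabola x) < e" by blast
  qed
  moreover have "parabola x \<notin> outside S" using x outside_no_overlap[of S] by blast
  ultimately show ?thesis using interior_subset unfolding frontier_def by blast
qed

text \<open>The vertex \<open>v\<close> is placed at the point of the parabola with abscissa
  \<open>f v\<close>, and edges become chords, oriented from left to right by
  \<open>ab\<close>.\<close>

lemma noncrossing_imp_outerplanar:
  assumes sg: "simple_graph V E" and inj: "inj_on f V" and nc: "noncrossing f E"
  shows "outerplanar V E"
proof -
  have "\<forall>e\<in>E. \<exists>ab. e = {fst ab, snd ab} \<and> f (fst ab) < f (snd ab)"
  proof
    fix e assume "e \<in> E"
    then have "e \<subseteq> V" "card e = 2" using sg unfolding simple_graph_def by auto
    then obtain u v where uv: "e = {u, v}" "u \<noteq> v" "u \<in> V" "v \<in> V" unfolding card_2_iff by auto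
    then have "f u \<noteq> f v" using inj by (auto simp: inj_on_def)
    then consider "f u < f v" | "f v < f u" by linarith
    then show "\<exists>ab. e = {fst ab, snd ab} \<and> f (fst ab) < f (snd ab)"
    proof cases
      case 1
      then show ?thesis using uv by (intro exI[of _ "(u, v)"]) simp
    next
      case 2
      then show ?thesis using uv by (intro exI[of _ "(v, u)"]) auto
    qed
  qed
  then obtain ab where ab: "\<And>e. e \<in> E \<Longrightarrow> e = {fst (ab e), snd (ab e)} \<and> f (fst (ab e)) < f (snd (ab e))"
    by metis
  define p where "p = (\<lambda>v. parabola (f v))"
  define g where "g = (\<lambda>e. linepath (p (fst (ab e))) (p (snd (ab e))))"
  have V: "fst (ab e) \<in> V" "snd (ab e) \<in> V" if "e \<in> E" for e
    using ab[OF that] that sg unfolding simple_graph_def by auto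
  have img: "path_image (g e) = closed_segment (parabola (f (fst (ab e)))) (parabola (f (snd (ab e))))" for e
    by (simp add: g_def p_def)
  have injp: "inj_on p V" using inj by (auto simp: inj_on_def p_def)
  have ends: "p ` e \<subseteq> path_image (g e)" if "e \<in> E" for e
    using arg_cong[OF conjunct1[OF ab[OF that]], of "(`) p"] unfolding img by (simp add: p_def)
  have "plane_drawing V E p g"
    unfolding plane_drawing_def
  proof (intro conjI ballI impI)
    fix e assume e: "e \<in> E"
    show "arc (g e)" using ab[OF e] by (auto simp: g_def p_def intro!: arc_linepath)
    show "{pathstart (g e), pathfinish (g e)} = p ` e"
      using arg_cong[OF conjunct1[OF ab[OF e]], of "(`) p"] by (simp add: g_def)
    show "path_image (g e) \<inter> p ` V = p ` e"
    proof
      show "p ` e \<subseteq> path_image (g e) \<inter> p ` V"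
        using ends[OF e] e sg unfolding simple_graph_def by blast
      show "path_image (g e) \<inter> p ` V \<subseteq> p ` e"
      proof
        fix z assume "z \<in> path_image (g e) \<inter> p ` V"
        then obtain v where v: "v \<in> V" "z = p v" "p v \<in> path_image (g e)" by blast
        then have "f v = f (fst (ab e)) \<or> f v = f (snd (ab e))"
          using vertex_on_chord ab[OF e] unfolding img p_def by blast
        then have "v = fst (ab e) \<or> v = snd (ab e)" using inj V[OF e] v(1) by (auto simp: inj_on_def)
        then have "v \<in> e" using ab[OF e] by blast
        with v show "z \<in> p ` e" by blast
      qed
    qed
  next
    fix e h assume e: "e \<in> E" and h: "h \<in> E" and "e \<noteq> h"
    note abe = ab[OF e] and abh = ab[OF h]
    define a b c d where "a = fst (ab e)" "b = snd (ab e)" "c = fst (ab h)" "d = snd (ab h)"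
    note abcd = a_b_c_d_def
    have eq: "e = {a, b}" "h = {c, d}" and lt: "f a < f b" "f c < f d"
      using abe abh unfolding abcd by blast+
    have inV: "{a, b, c, d} \<subseteq> V" using V[OF e] V[OF h] unfolding abcd by blast
    have edges: "{a, b} \<in> E" "{c, d} \<in> E" using eq e h by simp_all
    have "(f a, f b) \<noteq> (f c, f d)" using \<open>e \<noteq> h\<close> inV inj unfolding eq inj_on_def by auto
    moreover have "\<not> (f a < f c \<and> f c < f b \<and> f b < f d)" "\<not> (f c < f a \<and> f a < f d \<and> f d < f b)"
      using nc edges unfolding noncrossing_def by blast+
    ultimately have "path_image (g e) \<inter> path_image (g h) \<subseteq> parabola ` ({f a, f b} \<inter> {f c, f d})"
      using chords_meet_at_ends[OF lt] unfolding img abcd by blast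
    also have "{f a, f b} \<inter> {f c, f d} = f ` (e \<inter> h)"
      using inj inV unfolding eq inj_on_def by fastforce
    finally show "path_image (g e) \<inter> path_image (g h) \<subseteq> p ` (e \<inter> h)"
      by (simp add: p_def image_image)
  qed (rule injp)
  moreover have "p ` V \<subseteq> frontier (outside (drawing_image V E p g))"
  proof -
    have "path_image (g e) \<subseteq> {z. (Re z)\<^sup>2 \<le> Im z}" if "e \<in> E" for e
    proof
      fix z assume z: "z \<in> path_image (g e)"
      note h = chord_height[OF conjunct2[OF ab[OF that]] z[unfolded img]]
      then have "0 \<le> Im z - (Re z)\<^sup>2" by simp
      then show "z \<in> {z. (Re z)\<^sup>2 \<le> Im z}" by simp
    qed
    then have "drawing_image V E p g \<subseteq> {z. (Re z)\<^sup>2 \<le> Im z}"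
      unfolding drawing_image_def by (auto simp: p_def parabola_def)
    then show ?thesis
      using parabola_frontier_outside unfolding drawing_image_def p_def by blast
  qed
  ultimately show ?thesis using sg unfolding outerplanar_def by blast
qed

subsection \<open>Rotations of the zigzag strip\<close>

text \<open>The sequence 0, \<open>t - 1\<close>, 1, \<open>t - 2\<close>, ..., known from Walecki's
  decompositions of complete graphs into Hamiltonian paths.\<close>

definition zigzag :: "nat \<Rightarrow> nat \<Rightarrow> nat" where
  "zigzag t m = (if even m then m div 2 else t - 1 - m div 2)"

lemma zigzag_0 [simp]: "zigzag t 0 = 0"
  by (simp add: zigzag_def)

lemma zigzag_less: "m < t \<Longrightarrow> zigzag t m < t"
  by (auto simp: zigzag_def)

lemma zigzag_inj: "m < t \<Longrightarrow> m' < t \<Longrightarrow> zigzag t m = zigzag t m' \<Longrightarrow> m = m'"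
  by (auto simp: zigzag_def elim!: evenE oddE split: if_splits)

text \<open>A rotation by \<open>j\<close> adds \<open>2 * j\<close> to these sums. As they take two
  adjacent values, halving after a suitable offset recovers \<open>j\<close> from an edge between
  consecutive positions.\<close>

lemma zigzag_Suc:
  assumes "Suc m < t"
  shows "zigzag t m + zigzag t (Suc m) = (if even m then t - 1 else t)"
proof (cases "even m")
  case True
  then obtain k where "m = 2 * k" by (elim evenE)
  then show ?thesis using assms by (simp add: zigzag_def)
next
  case False
  then obtain k where "m = 2 * k + 1" by (elim oddE)
  then show ?thesis using assms by (simp add: zigzag_def)
qed

text \<open>The \<open>4 * t\<close> positions form four blocks of length \<open>t\<close>. Every position is joined to the start of
  the next block (cyclically) and to its successor; one chord joins the starts of blocks \<open>0\<close> and \<open>2\<close>.\<close>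
definition strip :: "nat \<Rightarrow> (nat \<times> nat) set" where
  "strip t = (\<lambda>(c, m). (c * t + m, Suc c * t)) ` ({..<3} \<times> {..<t}) \<union>
     (\<lambda>m. (0, 3 * t + m)) ` {..<t} \<union> {(0, 2 * t)} \<union>
     (\<lambda>(c, m). (c * t + m, Suc (c * t + m))) ` ({..<4} \<times> {..<t - 1})"

text \<open>Blocks 0 and 2 fill one copy, blocks 1 and 3 the other; the second block of each pair is
  the first raised by \<open>t\<close>. The zigzag is reflected in odd blocks, so that blocks 0 and
  1 end their chords at the heights \<open>t - 1\<close> and \<open>t\<close>.\<close>

definition height :: "nat \<Rightarrow> nat \<Rightarrow> nat" where
  "height t r = (if even (r div t) then zigzag t (r mod t) else t - 1 - zigzag t (r mod t)) + t * (r div t div 2)"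

text \<open>The label \<open>2 * x + k\<close> stands for the element \<open>x\<close> of the \<open>k\<close>-th of two copies of the integers
  modulo \<open>2 * t\<close>; \<open>j\<close> is a rotation of both copies. The strip is mapped to itself by the half turn
  \<open>x + t\<close>.\<close>
definition label :: "nat \<Rightarrow> nat \<Rightarrow> nat \<Rightarrow> nat" where
  "label t j r = 2 * ((height t r + j) mod (2 * t)) + r div t mod 2"

lemma block_cases:
  fixes r t :: nat
  assumes "r < 4 * t"
  obtains c m where "r = c * t + m" "c < 4" "m < t"
proof
  show "r = r div t * t + r mod t" by simp
  show "r div t < 4" using assms by (simp add: less_mult_imp_div_less)
  show "r mod t < t" using assms by (cases t) auto
qed

lemma block_div_mod:
  assumes "m < (t::nat)"
  shows "(c * t + m) div t = c" "(c * t + m) mod t = m"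
  using assms by auto

lemma height_block:
  "m < t \<Longrightarrow> height t (c * t + m) = (if even c then zigzag t m else t - 1 - zigzag t m) + t * (c div 2)"
  unfolding height_def by (simp only: block_div_mod)

lemma label_block:
  "m < t \<Longrightarrow> label t j (c * t + m) = 2 * ((height t (c * t + m) + j) mod (2 * t)) + c mod 2"
  unfolding label_def by (simp only: block_div_mod)

lemma label_less:
  assumes "r < 4 * t"
  shows "label t j r < 4 * t"
proof -
  have "(height t r + j) mod (2 * t) < 2 * t" using assms by simp
  moreover have "r div t mod 2 < 2" by simp
  ultimately show ?thesis unfolding label_def by linarith
qed

lemma label_inj: "inj_on (label t j) {..<4 * t}"
proof (rule inj_onI)
  fix r s assume "r \<in> {..<4 * t}" "s \<in> {..<4 * t}" and eq: "label t j r = label t j s"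
  then obtain c m d k where r: "r = c * t + m" "c < 4" "m < t" and s: "s = d * t + k" "d < 4" "k < t"
    using block_cases by (metis lessThan_iff)
  \<comment> \<open>Heights within the block. The parity of \<open>c\<close> is used for
    \<open>y\<close> too, since \<open>par\<close> shows that \<open>d\<close> has the same
    parity.\<close>
  define x y where "x = (if even c then zigzag t m else t - 1 - zigzag t m)"
    and "y = (if even c then zigzag t k else t - 1 - zigzag t k)"
  have xy: "x < t" "y < t" using zigzag_less[OF r(3)] zigzag_less[OF s(3)] by (auto simp: x_def y_def)
  have par: "c mod 2 = d mod 2"
    using arg_cong[OF eq, of "\<lambda>z. z mod 2"] r s by (simp add: label_block)
  then have hr: "height t r = x + t * (c div 2)" and hs: "height t s = y + t * (d div 2)"
    using r s by (auto simp: height_block x_def y_def parity_cases even_iff_mod_2_eq_zero)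
  have "(height t r + j) mod (2 * t) = (height t s + j) mod (2 * t)"
    using eq par unfolding r(1) s(1) label_block[OF r(3)] label_block[OF s(3)] by simp
  then have "(int (height t r) + int j) mod int (2 * t) = (int (height t s) + int j) mod int (2 * t)"
    by (metis of_nat_add of_nat_mod)
  from mod_diff_cong[OF this, of "int j" "int j"]
  have "int (height t r) mod int (2 * t) = int (height t s) mod int (2 * t)" by simp
  then have "height t r mod (2 * t) = height t s mod (2 * t)"
    by (metis of_nat_mod of_nat_eq_iff)
  moreover have "t * (c div 2) \<le> t" "t * (d div 2) \<le> t"
    using mult_le_mono2[of "c div 2" 1 t] mult_le_mono2[of "d div 2" 1 t] r s by auto
  then have "height t r < 2 * t" "height t s < 2 * t" using hr hs xy by linarith+
  ultimately have "height t r = height t s" by simp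
  then have h: "x + t * (c div 2) = y + t * (d div 2)" using hr hs by simp
  have "x = y" using arg_cong[OF h, of "\<lambda>z. z mod t"] xy by simp
  moreover from h this have "c div 2 = d div 2" using xy by simp
  ultimately have "c = d" using par by (metis div_mod_decomp)
  with \<open>x = y\<close> have "zigzag t m = zigzag t k"
    using zigzag_less[OF r(3)] zigzag_less[OF s(3)] by (auto simp: x_def y_def split: if_splits)
  then show "r = s" using zigzag_inj[OF r(3) s(3)] r s \<open>c = d\<close> by simp
qed

lemma less_3_cases: "(c::nat) < 3 \<longleftrightarrow> c = 0 \<or> c = 1 \<or> c = 2"
  by auto

lemma less_4_cases: "(c::nat) < 4 \<longleftrightarrow> c = 0 \<or> c = 1 \<or> c = 2 \<or> c = 3"
  by auto

text \<open>A linear description of the edges, after which being noncrossing is a matter of linear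
  arithmetic.\<close>

lemma strip_cases:
  assumes "(a, b) \<in> strip t"
  shows "a < t \<and> b = t \<or> t \<le> a \<and> a < 2 * t \<and> b = 2 * t \<or> 2 * t \<le> a \<and> a < 3 * t \<and> b = 3 * t \<or>
    a = 0 \<and> 3 * t \<le> b \<and> b < 4 * t \<or> a = 0 \<and> b = 2 * t \<or> b = Suc a \<and> b < 4 * t"
  using assms unfolding strip_def
proof (elim UnE)
  assume "(a, b) \<in> (\<lambda>(c, m). (c * t + m, Suc c * t)) ` ({..<3} \<times> {..<t})"
  then obtain c m where "c < 3" "m < t" "a = c * t + m" "b = Suc c * t" by auto
  then show ?thesis unfolding less_3_cases by (elim disjE) simp_all
next
  assume "(a, b) \<in> (\<lambda>(c, m). (c * t + m, Suc (c * t + m))) ` ({..<4} \<times> {..<t - 1})"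
  then obtain c m where "c < 4" "m < t - 1" "b = Suc a" "a = c * t + m" by auto
  moreover from this have "b < 4 * t" unfolding less_4_cases by (elim disjE) simp_all
  ultimately show ?thesis by blast
qed auto

lemma strip_less:
  assumes "t \<ge> 1" "(a, b) \<in> strip t"
  shows "a < b" "b < 4 * t"
  using strip_cases[OF assms(2)] assms(1) by (elim disjE; simp)+

lemma strip_noncrossing:
  assumes "(a, b) \<in> strip t" "(c, d) \<in> strip t"
  shows "\<not> (a < c \<and> c < b \<and> b < d)"
  using strip_cases[OF assms(1)] strip_cases[OF assms(2)] by linarith

text \<open>Successor edges stop before the end of each block, where the next edge of the polygon is
  already counted among the chords to block starts. So the families are disjoint, and the total is
  \<open>2 * (4 * t) - 3\<close>.\<close>

lemma card_strip:
  assumes "t \<ge> 1"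
  shows "card (strip t) = 8 * t - 3"
proof -
  let ?A = "(\<lambda>(c, m). (c * t + m, Suc c * t)) ` ({..<3} \<times> {..<t})"
  let ?B = "(\<lambda>m. (0, 3 * t + m)) ` {..<t}"
  let ?D = "(\<lambda>(c, m). (c * t + m, Suc (c * t + m))) ` ({..<4} \<times> {..<t - 1})"
  have inj: "c = d \<and> m = k" if "c * t + m = d * t + k" "m < t" "k < t" for c m d k
    using block_div_mod that by metis
  have "card ?A = 3 * t"
    by (subst card_image) (auto simp: inj_on_def dest: inj)
  moreover have "card ?B = t"
    by (subst card_image) (auto simp: inj_on_def)
  moreover have "card ?D = 4 * (t - 1)"
    by (subst card_image) (auto simp: inj_on_def dest: inj)
  moreover have "?A \<inter> ?B = {}" "(?A \<union> ?B) \<inter> {(0, 2 * t)} = {}"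
    using assms by (auto simp: less_3_cases)
  moreover have "(?A \<union> ?B \<union> {(0, 2 * t)}) \<inter> ?D = {}"
    using assms by (auto simp: less_3_cases less_4_cases)
  ultimately have "card (strip t) = 3 * t + t + 1 + 4 * (t - 1)"
    unfolding strip_def by (simp add: card_Un_disjoint)
  then show ?thesis using assms by simp
qed

text \<open>\<open>x\<close> is the end in the even copy, \<open>y\<close> that in the odd copy.
  Differences below \<open>t\<close> come from blocks 0 and 2, where \<open>y\<close> is
  \<open>t - 1 + j\<close> or \<open>2 * t - 1 + j\<close> modulo \<open>2 * t\<close>; the others
  come from blocks 1 and 3, where \<open>x\<close> is \<open>t + j\<close> or
  \<open>j\<close>.\<close>

definition shift_mixed :: "nat \<Rightarrow> nat \<Rightarrow> nat \<Rightarrow> nat" where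
  "shift_mixed t x y = (if (int y - int x) mod int (2 * t) < int t then (y + 1) mod t else x mod t)"

text \<open>This recovers the rotation \<open>j\<close> from an edge of the rotated strip: from the sum of the ends, for
  an edge within one copy, and otherwise from their difference, which tells how far the ends were
  rotated away from their original place.\<close>
definition shift :: "nat \<Rightarrow> nat \<Rightarrow> nat \<Rightarrow> nat" where
  "shift t u v =
     (if even u = even v then (u div 2 + v div 2 + t + 1 + u mod 2) div 2 mod t
      else if even u then shift_mixed t (u div 2) (v div 2) else shift_mixed t (v div 2) (u div 2))"

lemma shift_commute: "shift t u v = shift t v u"
proof (cases "even u = even v")
  case True
  then have "u mod 2 = v mod 2" by presburger
  with True show ?thesis by (simp add: shift_def add.commute[of "u div 2"])
next
  case False
  then show ?thesis by (auto simp: shift_def)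
qed

lemma half_mod_add:
  fixes N t q :: nat
  shows "(N + 2 * (t * q)) div 2 mod t = N div 2 mod t"
  by simp

text \<open>Reducing the ends modulo \<open>2 * t\<close> changes their sum by a multiple of
  \<open>2 * t\<close>, hence its half by a multiple of \<open>t\<close>.\<close>

lemma half_mod_cong:
  fixes a b e x y t :: nat
  assumes "x = a mod (2 * t)" "y = b mod (2 * t)"
  shows "(x + y + e) div 2 mod t = (a + b + e) div 2 mod t"
proof -
  have "a + b + e = x + y + e + 2 * (t * (a div (2 * t) + b div (2 * t)))"
    using assms div_mult_mod_eq[of a "2 * t"] div_mult_mod_eq[of b "2 * t"]
    by (simp add: algebra_simps)
  then show ?thesis by (simp only: half_mod_add)
qed

text \<open>The two alternatives are the two branches of \<open>shift_mixed\<close> before rotation: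
  the odd end is one below a multiple of \<open>t\<close>, or the even end is a multiple of
  \<open>t\<close>. \<open>r\<close> counts how often the difference wraps around.\<close>

lemma shift_mixed_eq:
  fixes h h' j t :: nat
  assumes "j < t"
    and "h' = h + d \<and> d < t \<and> h' + 1 = t * q \<or> h' + 2 * t * r = h + t + d \<and> d < t \<and> h = t * q"
  shows "shift_mixed t ((h + j) mod (2 * t)) ((h' + j) mod (2 * t)) = j"
proof -
  have diff: "(int ((h' + j) mod (2 * t)) - int ((h + j) mod (2 * t))) mod int (2 * t) =
      (int h' - int h) mod int (2 * t)"
    by (simp add: zmod_int mod_simps)
  have mod2: "z mod (2 * t) mod t = z mod t" for z :: nat
    by (simp add: mod_mod_cancel)
  from assms(2) show ?thesis
  proof (elim disjE conjE)
    assume a: "h' = h + d" "d < t" "h' + 1 = t * q"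
    have "(int h' - int h) mod int (2 * t) = int d" using a by simp
    moreover have "((h' + j) mod (2 * t) + 1) mod t = (h' + j + 1) mod t"
      by (metis mod2 mod_add_left_eq)
    moreover have "h' + j + 1 = t * q + j" using a by simp
    ultimately show ?thesis
      using a(2) assms(1) unfolding shift_mixed_def diff by (simp only: mod_mult_self4 mod_less of_nat_less_iff if_True)
  next
    assume a: "h' + 2 * t * r = h + t + d" "d < t" "h = t * q"
    have "int h' - int h = int (t + d) + int (2 * t) * (- int r)"
      using arg_cong[OF a(1), of int] by (simp add: algebra_simps)
    then have "(int h' - int h) mod int (2 * t) = int (t + d) mod int (2 * t)"
      by (simp only: mod_mult_self2)
    also have "\<dots> = int (t + d)" using a by simp
    finally show ?thesis using a assms(1) unfolding shift_mixed_def diff by (simp add: mod2)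
  qed
qed

lemma shift_label_strip:
  assumes "j < t" "(a, b) \<in> strip t"
  shows "shift t (label t j a) (label t j b) = j"
proof -
  have mixed: "shift t (2 * x) (2 * y + 1) = shift_mixed t x y" "shift t (2 * y + 1) (2 * x) = shift_mixed t x y" for x y
    by (simp_all add: shift_def)
  have pure: "shift t (2 * (x mod (2 * t)) + k) (2 * (y mod (2 * t)) + k) = (x + y + (t + 1 + k)) div 2 mod t"
    if "k < 2" for x y k
  proof -
    have "shift t (2 * (x mod (2 * t)) + k) (2 * (y mod (2 * t)) + k) =
      (x mod (2 * t) + y mod (2 * t) + (t + 1 + k)) div 2 mod t"
      using that by (auto simp: shift_def less_2_cases_iff add.assoc)
    then show ?thesis using half_mod_cong[OF refl refl] by metis
  qed
  have t: "0 < t" using assms by simp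
  note L = label_block height_block
  from assms(2) show ?thesis
    unfolding strip_def
  proof (elim UnE)
    assume "(a, b) \<in> (\<lambda>(c, m). (c * t + m, Suc c * t)) ` ({..<3} \<times> {..<t})"
    then obtain c m where c: "c < 3" and m: "m < t" and ab: "a = c * t + m" "b = Suc c * t + 0" by auto
    note z = zigzag_less[OF m]
    note la = label_block[OF m, of j c, folded ab(1)] and ha = height_block[OF m, of c, folded ab(1)]
    note lb = label_block[OF t, of j "Suc c", folded ab(2)] and hb = height_block[OF t, of "Suc c", folded ab(2)]
    from c consider "c = 0" | "c = 1" | "c = 2" by linarith
    then show ?thesis
    proof cases
      case 1
      have h: "height t a = zigzag t m" "height t b = t - 1" using 1 ha hb by simp_all
      have "shift_mixed t ((height t a + j) mod (2 * t)) ((height t b + j) mod (2 * t)) = j"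
        by (rule shift_mixed_eq[where d = "t - 1 - zigzag t m" and q = 1]) (use h z assms(1) in auto)
      then show ?thesis unfolding la lb using 1 mixed by simp
    next
      case 2
      have h: "height t a = t - 1 - zigzag t m" "height t b = t" using 2 ha hb by simp_all
      \<comment> \<open>In block 1 the end in the even copy is \<open>b\<close>, so the arguments
        are exchanged; \<open>r = 1\<close> because the height of \<open>a\<close> is below that of
        \<open>b\<close>.\<close>
      have "shift_mixed t ((height t b + j) mod (2 * t)) ((height t a + j) mod (2 * t)) = j"
        by (rule shift_mixed_eq[where d = "t - 1 - zigzag t m" and q = 1 and r = 1]) (use h z assms(1) in auto)
      then show ?thesis unfolding la lb using 2 mixed by simp
    next
      case 3
      have h: "height t a = zigzag t m + t" "height t b = t - 1 + t" using 3 ha hb by simp_all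
      have "shift_mixed t ((height t a + j) mod (2 * t)) ((height t b + j) mod (2 * t)) = j"
        by (rule shift_mixed_eq[where d = "t - 1 - zigzag t m" and q = 2]) (use h z assms(1) in auto)
      then show ?thesis unfolding la lb using 3 mixed by simp
    qed
  next
    assume "(a, b) \<in> (\<lambda>m. (0, 3 * t + m)) ` {..<t}"
    then obtain m where m: "m < t" and ab: "a = 0 * t + 0" "b = 3 * t + m" by auto
    note z = zigzag_less[OF m]
    note la = label_block[OF t, of j 0, folded ab(1)] and ha = height_block[OF t, of 0, folded ab(1)]
    note lb = label_block[OF m, of j 3, folded ab(2)] and hb = height_block[OF m, of 3, folded ab(2)]
    have h: "height t a = 0" "height t b = t - 1 - zigzag t m + t" using ha hb by simp_all
    have "shift_mixed t ((height t a + j) mod (2 * t)) ((height t b + j) mod (2 * t)) = j"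
      by (rule shift_mixed_eq[where d = "t - 1 - zigzag t m" and q = 0 and r = 0]) (use h z assms(1) in auto)
    then show ?thesis unfolding la lb using mixed by simp
  next
    assume "(a, b) \<in> {(0, 2 * t)}"
    then have ab: "a = 0 * t + 0" "b = 2 * t + 0" by auto
    note la = label_block[OF t, of j 0, folded ab(1)] and ha = height_block[OF t, of 0, folded ab(1)]
    note lb = label_block[OF t, of j 2, folded ab(2)] and hb = height_block[OF t, of 2, folded ab(2)]
    have h: "height t a = 0" "height t b = t" using ha hb by simp_all
    have "shift t (label t j a) (label t j b) = (height t a + j + (height t b + j) + (t + 1 + 0)) div 2 mod t"
      using pure[of 0 "height t a + j" "height t b + j"] unfolding la lb by simp
    also have "height t a + j + (height t b + j) + (t + 1 + 0) = 2 * (t + j) + 1" using h by simp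
    finally show ?thesis using assms(1) by simp
  next
    assume "(a, b) \<in> (\<lambda>(c, m). (c * t + m, Suc (c * t + m))) ` ({..<4} \<times> {..<t - 1})"
    then obtain c m where c: "c < 4" and m: "m < t - 1" and ab: "a = c * t + m" "b = c * t + Suc m" by auto
    from m have m: "m < t" "Suc m < t" by simp_all
    note la = label_block[OF m(1), of j c, folded ab(1)] and ha = height_block[OF m(1), of c, folded ab(1)]
    note lb = label_block[OF m(2), of j c, folded ab(2)] and hb = height_block[OF m(2), of c, folded ab(2)]
    note z = zigzag_less[OF m(1)] zigzag_less[OF m(2)] zigzag_Suc[OF m(2)]
    have "shift t (label t j a) (label t j b) = (height t a + j + (height t b + j) + (t + 1 + c mod 2)) div 2 mod t"
      unfolding la lb by (rule pure) simp
    \<comment> \<open>The offset \<open>t + 1 + c mod 2\<close> in \<open>shift\<close> brings both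
      alternating sums to \<open>2 * j + 2 * t\<close> or one more, with equal halves. Blocks 2 and
      3 add only a multiple of \<open>2 * t\<close>.\<close>
    also have "height t a + j + (height t b + j) + (t + 1 + c mod 2) =
        (if even c = even m then 2 * j + 2 * t else 2 * j + 2 * t + 1) + 2 * (t * (c div 2))"
    proof (cases "even c")
      case True
      then have "height t a + height t b = (if even m then t - 1 else t) + 2 * (t * (c div 2))" "c mod 2 = 0"
        using ha hb z(3) by simp_all
      with True t show ?thesis by (cases "even m") simp_all
    next
      case False
      then have "c mod 2 = 1" by presburger
      have "height t a = t - 1 - zigzag t m + t * (c div 2)"
        "height t b = t - 1 - zigzag t (Suc m) + t * (c div 2)"
        using ha hb False by simp_all
      moreover have "t - 1 - zigzag t m + (t - 1 - zigzag t (Suc m)) = (if even m then t - 1 else t - 2)"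
      proof (cases "even m")
        case True
        then have "zigzag t m + zigzag t (Suc m) = t - 1" using z(3) by simp
        then show ?thesis using z(1,2) True by simp
      next
        case False
        then have "zigzag t m + zigzag t (Suc m) = t" using z(3) by simp
        then show ?thesis using z(1,2) False by simp
      qed
      ultimately have "height t a + height t b = (if even m then t - 1 else t - 2) + 2 * (t * (c div 2))"
        by linarith
      with False \<open>c mod 2 = 1\<close> m show ?thesis by (cases "even m") simp_all
    qed
    finally have "shift t (label t j a) (label t j b) =
        (if even c = even m then 2 * j + 2 * t else 2 * j + 2 * t + 1) div 2 mod t"
      by (simp only: half_mod_add)
    also have "(if even c = even m then 2 * j + 2 * t else 2 * j + 2 * t + 1) div 2 = j + t" by simp
    finally show ?thesis using assms(1) by simp
  qed
qed

subsection \<open>Packings of noncrossing graphs\<close>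

text \<open>Each graph has its own order \<open>f i\<close> of the common vertex set. The positions
  are real so that a further vertex fits between any two.\<close>

definition packing :: "nat \<Rightarrow> nat \<Rightarrow> (nat \<Rightarrow> nat set set) \<Rightarrow> (nat \<Rightarrow> nat \<Rightarrow> real) \<Rightarrow> bool" where
  "packing t n E f \<longleftrightarrow>
     (\<forall>i<t. simple_graph {..<n} (E i) \<and> card (E i) = 2 * n - 3 \<and> inj_on (f i) {..<n} \<and> noncrossing (f i) (E i)) \<and>
     (\<forall>i<t. \<forall>j<t. i \<noteq> j \<longrightarrow> E i \<inter> E j = {})"

text \<open>Vertices of the rotation by \<open>j\<close> are ordered by the inverse of
  \<open>label t j\<close>; disjointness holds because \<open>shift\<close> reads \<open>j\<close>
  off every edge.\<close>

lemma packing_strip: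
  assumes "t \<ge> 1"
  shows "packing t (4 * t) (\<lambda>j. (\<lambda>(a, b). {label t j a, label t j b}) ` strip t)
    (\<lambda>j v. real (inv_into {..<4 * t} (label t j) v))"
    (is "packing t _ ?E ?f")
  unfolding packing_def
proof (intro conjI allI impI)
  fix j assume "j < t"
  note inj = label_inj[of t j]
  have S: "a < b" "a < 4 * t" "b < 4 * t" if "(a, b) \<in> strip t" for a b
    using strip_less[OF assms that] by simp_all
  have less: "label t j a < 4 * t" if "a < 4 * t" for a using label_less[OF that] .
  have eq_iff: "label t j a = label t j b \<longleftrightarrow> a = b" if "a < 4 * t" "b < 4 * t" for a b
    using inj that by (auto simp: inj_on_def)
  have bij: "label t j ` {..<4 * t} = {..<4 * t}"
    using less by (intro card_subset_eq) (auto simp: card_image[OF inj])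
  show "simple_graph {..<4 * t} (?E j)"
    unfolding simple_graph_def using S less eq_iff by (fastforce simp: card_insert_if)
  have "inj_on (\<lambda>(a, b). {label t j a, label t j b}) (strip t)"
  proof (rule inj_onI, clarify)
    fix a b c d assume ab: "(a, b) \<in> strip t" and cd: "(c, d) \<in> strip t"
      and "{label t j a, label t j b} = {label t j c, label t j d}"
    then have "a = c \<and> b = d \<or> a = d \<and> b = c"
      using eq_iff S[OF ab] S[OF cd] by (auto simp: doubleton_eq_iff)
    with S(1)[OF ab] S(1)[OF cd] show "a = c \<and> b = d" by auto
  qed
  then show "card (?E j) = 2 * (4 * t) - 3"
    using card_strip[OF assms] by (simp add: card_image)
  show "inj_on (?f j) {..<4 * t}"
    using inj_on_inv_into[of "{..<4 * t}" "label t j" "{..<4 * t}"] bij by (auto simp: inj_on_def)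
  show "noncrossing (?f j) (?E j)"
    unfolding noncrossing_def
  proof (intro allI impI notI)
    fix a b c d
    assume ab: "{a, b} \<in> ?E j" and cd: "{c, d} \<in> ?E j"
      and cross: "?f j a < ?f j c \<and> ?f j c < ?f j b \<and> ?f j b < ?f j d"
    have edge: "(inv_into {..<4 * t} (label t j) a, inv_into {..<4 * t} (label t j) b) \<in> strip t"
      if "{a, b} \<in> ?E j" "?f j a < ?f j b" for a b
    proof -
      from that(1) obtain z where z: "{a, b} = (case z of (x, y) \<Rightarrow> {label t j x, label t j y})" "z \<in> strip t"
        by (rule imageE)
      obtain x y where "z = (x, y)" by (cases z)
      with z have xy: "(x, y) \<in> strip t" "{a, b} = {label t j x, label t j y}" by simp_all
      then have "inv_into {..<4 * t} (label t j) (label t j x) = x" "inv_into {..<4 * t} (label t j) (label t j y) = y"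
        using S[OF xy(1)] inj by simp_all
      then show ?thesis using xy S[OF xy(1)] that(2) by (auto simp: doubleton_eq_iff)
    qed
    show False
      using strip_noncrossing[OF edge[OF ab] edge[OF cd]] cross by simp
  qed
next
  fix i j assume ij: "i < t" "j < t" "i \<noteq> j"
  show "?E i \<inter> ?E j = {}"
  proof (rule ccontr)
    assume "?E i \<inter> ?E j \<noteq> {}"
    then obtain a b c d where "(a, b) \<in> strip t" "(c, d) \<in> strip t"
      "{label t i a, label t i b} = {label t j c, label t j d}" by auto
    with shift_label_strip[OF ij(1)] shift_label_strip[OF ij(2)] ij(3) shift_commute
    show False by (metis doubleton_eq_iff)
  qed
qed

text \<open>Sending each vertex outside \<open>U\<close>, except the last vertex of
  \<open>V\<close>, to its successor is injective. There are more than \<open>card U\<close> such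
  vertices, so some successor avoids \<open>U\<close>.\<close>

lemma consecutive_outside:
  fixes f :: "'a \<Rightarrow> real"
  assumes fin: "finite V" and inj: "inj_on f V" and U: "finite U" "2 * card U + 1 < card V"
  obtains u v where "u \<in> V - U" "v \<in> V - U" "f u < f v" "\<And>w. w \<in> V \<Longrightarrow> \<not> (f u < f w \<and> f w < f v)"
proof -
  have "V \<noteq> {}" using U by auto
  then obtain M where M: "M \<in> V" "\<And>w. w \<in> V \<Longrightarrow> f w \<le> f M"
    using obtains_MAX[of V f] fin by (metis Max_ge finite_imageI imageI)
  define succ where "succ = (\<lambda>x. arg_min_on f {w \<in> V. f x < f w})"
  have succ: "succ x \<in> V" "f x < f (succ x)" "\<And>w. w \<in> V \<Longrightarrow> f x < f w \<Longrightarrow> f (succ x) \<le> f w"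
    if "x \<in> V - {M}" for x
  proof -
    have "f x \<noteq> f M" using that inj M(1) by (auto simp: inj_on_def)
    then have "M \<in> {w \<in> V. f x < f w}" using M that by (auto simp: order.strict_iff_order)
    then have ne: "{w \<in> V. f x < f w} \<noteq> {}" "finite {w \<in> V. f x < f w}" using fin by auto
    from arg_min_if_finite(1)[OF ne(2,1), of f] show "succ x \<in> V" "f x < f (succ x)" by (auto simp: succ_def)
    fix w assume "w \<in> V" "f x < f w"
    then show "f (succ x) \<le> f w" using arg_min_least[OF ne(2,1), of w f] by (simp add: succ_def)
  qed
  let ?A = "V - U - {M}"
  have "inj_on succ ?A"
  proof (rule inj_onI, rule ccontr)
    have "f (succ x) < f (succ y)" if "x \<in> ?A" "y \<in> ?A" "f x < f y" for x y
      using succ(3)[of x y] succ(2)[of y] that by fastforce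
    moreover fix x y assume xy: "x \<in> ?A" "y \<in> ?A" "succ x = succ y" "x \<noteq> y"
    ultimately have "\<not> f x < f y" "\<not> f y < f x" by (metis order_less_irrefl)+
    with xy inj show False by (auto simp: inj_on_def)
  qed
  have "\<not> succ ` ?A \<subseteq> U"
  proof
    assume "succ ` ?A \<subseteq> U"
    then have "card ?A \<le> card U" using card_inj_on_le[OF \<open>inj_on succ ?A\<close>] U(1) by blast
    moreover have "card V - card U \<le> card (V - U)" using U(1) by (rule diff_card_le_card_Diff)
    moreover have "card (V - U) - card {M} \<le> card ?A" by (intro diff_card_le_card_Diff) simp
    ultimately show False using U(2) by simp
  qed
  then obtain x where x: "x \<in> ?A" "succ x \<notin> U" by blast
  with succ[of x] that[of x "succ x"] show ?thesis by fastforce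
qed

lemma packing_insertion_places:
  assumes pack: "packing t n E f" and n: "n \<ge> 4 * t"
  shows "k \<le> t \<Longrightarrow> \<exists>u v :: nat \<Rightarrow> nat.
    (\<forall>i<k. u i < n \<and> v i < n \<and> f i (u i) < f i (v i) \<and> (\<forall>w<n. \<not> (f i (u i) < f i w \<and> f i w < f i (v i)))) \<and>
    (\<forall>i<k. \<forall>j<k. i \<noteq> j \<longrightarrow> {u i, v i} \<inter> {u j, v j} = {})"
proof (induction k)
  case (Suc k)
  then obtain u v where uv: "\<forall>i<k. u i < n \<and> v i < n \<and> f i (u i) < f i (v i) \<and> (\<forall>w<n. \<not> (f i (u i) < f i w \<and> f i w < f i (v i)))"
    "\<forall>i<k. \<forall>j<k. i \<noteq> j \<longrightarrow> {u i, v i} \<inter> {u j, v j} = {}" by auto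
  define U where "U = u ` {..<k} \<union> v ` {..<k}"
  have "card U \<le> k + k" unfolding U_def
    by (rule order_trans[OF card_Un_le add_mono]) (use card_image_le[of "{..<k}"] in auto)
  \<comment> \<open>The \<open>k\<close> earlier pairs occupy at most \<open>2 * k\<close> vertices,
    and \<open>2 * (2 * k) + 1 < 4 * t\<close> because \<open>k < t\<close>.\<close>
  then have "2 * card U + 1 < card {..<n}" using Suc.prems n by simp
  moreover have "inj_on (f k) {..<n}" using pack Suc.prems by (auto simp: packing_def)
  moreover have "finite U" by (simp add: U_def)
  ultimately obtain a b where ab: "a \<in> {..<n} - U" "b \<in> {..<n} - U" "f k a < f k b"
      "\<And>w. w \<in> {..<n} \<Longrightarrow> \<not> (f k a < f k w \<and> f k w < f k b)"
    using consecutive_outside[of "{..<n}" "f k" U] by blast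
  have new: "{a, b} \<inter> {u i, v i} = {}" if "i < k" for i
    using ab that by (auto simp: U_def)
  have old: "(u(k := a)) i = u i" "(v(k := b)) i = v i" if "i < k" for i using that by auto
  show ?case
  proof (rule exI[of _ "u(k := a)"], rule exI[of _ "v(k := b)"], rule conjI)
    show "\<forall>i<Suc k. (u(k := a)) i < n \<and> (v(k := b)) i < n \<and> f i ((u(k := a)) i) < f i ((v(k := b)) i) \<and>
        (\<forall>w<n. \<not> (f i ((u(k := a)) i) < f i w \<and> f i w < f i ((v(k := b)) i)))"
      using uv(1) ab by (simp add: less_Suc_eq)
    show "\<forall>i<Suc k. \<forall>j<Suc k. i \<noteq> j \<longrightarrow>
        {(u(k := a)) i, (v(k := b)) i} \<inter> {(u(k := a)) j, (v(k := b)) j} = {}"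
    proof (intro allI impI)
      fix i j assume "i < Suc k" "j < Suc k" "i \<noteq> j"
      then consider "i < k" "j < k" | "i = k" "j < k" | "i < k" "j = k" by linarith
      then show "{(u(k := a)) i, (v(k := b)) i} \<inter> {(u(k := a)) j, (v(k := b)) j} = {}"
      proof cases
        case 1
        then show ?thesis unfolding old[OF 1(1)] old[OF 1(2)] using uv(2) \<open>i \<noteq> j\<close> by blast
      next
        case 2
        then show ?thesis unfolding old[OF 2(2)] 2(1) fun_upd_same using new by blast
      next
        case 3
        then show ?thesis unfolding old[OF 3(1)] 3(2) fun_upd_same using new by blast
      qed
    qed
  qed
qed auto

text \<open>The new vertex \<open>n\<close> is put midway between \<open>u i\<close> and
  \<open>v i\<close> in the \<open>i\<close>-th order and joined to both, which adds the two edges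
  needed. Disjoint pairs make these edges distinct for different \<open>i\<close>.\<close>

lemma packing_Suc:
  assumes pack: "packing t n E f" and n: "n \<ge> 4 * t"
  shows "\<exists>E f. packing t (Suc n) E f"
proof -
  from packing_insertion_places[OF pack n order_refl] obtain u v
    where places: "\<forall>i<t. u i < n \<and> v i < n \<and> f i (u i) < f i (v i) \<and> (\<forall>w<n. \<not> (f i (u i) < f i w \<and> f i w < f i (v i)))"
      "\<forall>i<t. \<forall>j<t. i \<noteq> j \<longrightarrow> {u i, v i} \<inter> {u j, v j} = {}"
    by (elim exE conjE)
  from places(1) have uv: "\<And>i. i < t \<Longrightarrow> u i < n \<and> v i < n \<and> f i (u i) < f i (v i)" by simp
  from places(1) have gap: "\<And>i w. i < t \<Longrightarrow> w < n \<Longrightarrow> \<not> (f i (u i) < f i w \<and> f i w < f i (v i))" by simp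
  from places(2) have disj: "\<And>i j. i < t \<Longrightarrow> j < t \<Longrightarrow> i \<noteq> j \<Longrightarrow> {u i, v i} \<inter> {u j, v j} = {}" by blast
  define E' where "E' = (\<lambda>i. E i \<union> {{u i, n}, {v i, n}})"
  define f' where "f' = (\<lambda>i. (f i)(n := (f i (u i) + f i (v i)) / 2))"
  have "packing t (Suc n) E' f'"
    unfolding packing_def
  proof (intro conjI allI impI)
    fix i assume i: "i < t"
    have sg: "simple_graph {..<n} (E i)" and inj: "inj_on (f i) {..<n}" and nc: "noncrossing (f i) (E i)"
      and card: "card (E i) = 2 * n - 3" using pack i by (auto simp: packing_def)
    have old: "e \<subseteq> {..<n}" "card e = 2" if "e \<in> E i" for e using sg that by (auto simp: simple_graph_def)
    note uvi = uv[OF i]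
    have f'n: "f i (u i) < f' i n" "f' i n < f i (v i)" using uvi by (auto simp: f'_def)
    have f'_old: "f' i w = f i w" if "w < n" for w using that by (simp add: f'_def)
    have un: "u i \<noteq> n" "v i \<noteq> n" "u i \<noteq> v i" using uvi by auto
    show sg': "simple_graph {..<Suc n} (E' i)"
    proof -
      have "E i \<subseteq> {e. e \<subseteq> {..<Suc n} \<and> card e = 2}" 
      proof
        fix e assume "e \<in> E i"
        from old[OF this] show "e \<in> {e. e \<subseteq> {..<Suc n} \<and> card e = 2}" by auto
      qed
      moreover have "{{u i, n}, {v i, n}} \<subseteq> {e. e \<subseteq> {..<Suc n} \<and> card e = 2}" using uvi un by auto
      ultimately show ?thesis by (simp add: simple_graph_def E'_def)
    qed
    have "{{u i, n}, {v i, n}} \<inter> E i = {}" using old(1) by blast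
    moreover have "card {{u i, n}, {v i, n}} = 2" using un by (simp add: doubleton_eq_iff)
    moreover have "finite (E i)" using simple_graph_finite_edges[OF sg] .
    ultimately have "card (E' i) = card (E i) + 2"
      unfolding E'_def by (subst card_Un_disjoint) auto
    then show "card (E' i) = 2 * Suc n - 3" using card n i by simp
    have ne: "f' i n \<noteq> f i w" if "w < n" for w using gap[OF i that] f'n by auto
    show "inj_on (f' i) {..<Suc n}"
    proof (rule inj_onI)
      fix x y assume "x \<in> {..<Suc n}" "y \<in> {..<Suc n}" "f' i x = f' i y"
      then show "x = y"
        using ne[of x] ne[of y] f'_old[of x] f'_old[of y] inj by (auto simp: less_Suc_eq inj_on_def)
    qed
    \<comment> \<open>No vertex lies strictly between the ends of a new edge, whereas each of two
      crossing edges has an end of the other strictly between its ends.\<close>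
    have empty: "\<not> (f' i a < f' i w \<and> f' i w < f' i b)" if "{a, b} \<in> {{u i, n}, {v i, n}}" "w < Suc n" for a b w
    proof (cases "w = n")
      case True
      with that(1) show ?thesis by (auto simp: doubleton_eq_iff)
    next
      case False
      with that have "w < n" by simp
      with gap[OF i this] that(1) f'n f'_old uvi show ?thesis by (auto simp: doubleton_eq_iff)
    qed
    show "noncrossing (f' i) (E' i)"
      unfolding noncrossing_def
    proof (intro allI impI notI)
      fix a b c d assume ab: "{a, b} \<in> E' i" and cd: "{c, d} \<in> E' i"
        and cross: "f' i a < f' i c \<and> f' i c < f' i b \<and> f' i b < f' i d"
      have lt: "a < Suc n" "b < Suc n" "c < Suc n" "d < Suc n"
        using ab cd sg' unfolding simple_graph_def by (blast dest: lessThan_iff[THEN iffD1])+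
      have "{a, b} \<notin> {{u i, n}, {v i, n}}" using empty lt cross by blast
      moreover have "{c, d} \<notin> {{u i, n}, {v i, n}}" using empty lt cross by blast
      ultimately have E: "{a, b} \<in> E i" "{c, d} \<in> E i" using ab cd by (auto simp: E'_def)
      then have "a < n" "b < n" "c < n" "d < n" using old by blast+
      with E cross nc f'_old show False unfolding noncrossing_def by metis
    qed
  next
    fix i j assume ij: "i < t" "j < t" "i \<noteq> j"
    have lt: "e \<subseteq> {..<n}" if "e \<in> E i \<union> E j" for e
      using pack ij that unfolding packing_def simple_graph_def by blast
    have "E i \<inter> E j = {}" using pack ij by (auto simp: packing_def)
    moreover have "{u i, n} \<notin> E j" "{v i, n} \<notin> E j" "{u j, n} \<notin> E i" "{v j, n} \<notin> E i"
      using lt by blast+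
    moreover have "{{u i, n}, {v i, n}} \<inter> {{u j, n}, {v j, n}} = {}"
      using disj[OF ij] uv[OF ij(1)] uv[OF ij(2)] by (auto simp: doubleton_eq_iff)
    ultimately show "E' i \<inter> E' j = {}" unfolding E'_def by blast
  qed
  then show ?thesis by blast
qed

lemma packing_exists:
  assumes "t \<ge> 1" "n \<ge> 4 * t"
  shows "\<exists>E f. packing t n E f"
  using assms(2)
proof (induction n rule: dec_induct)
  case base
  then show ?case using packing_strip[OF assms(1)] by blast
next
  case (step n)
  then show ?case using packing_Suc by blast
qed

section \<open>Outerthickness of the union of a packing\<close>

lemma outerplanar_edge_bound:
  assumes "outerplanar V E" "V \<noteq> {}"
  shows "card E \<le> 2 * card V - 2"
  using assms theta_free_edge_bound outerplanar_imp_theta_free unfolding outerplanar_def by blast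

lemma outerplanar_partition_card:
  assumes "partition_on E P" "finite P" "\<And>F. F \<in> P \<Longrightarrow> outerplanar V F" "V \<noteq> {}"
  shows "card E \<le> card P * (2 * card V - 2)"
proof -
  have "card E = card (\<Union>P)" using partition_onD1[OF assms(1)] by simp
  also have "\<dots> \<le> (\<Sum>F\<in>P. card F)" using card_Union_le_sum_card by blast
  also have "\<dots> \<le> (\<Sum>F\<in>P. 2 * card V - 2)"
    using outerplanar_edge_bound assms by (intro sum_mono) blast
  finally show ?thesis by simp
qed

theorem theorem1:
  fixes t n :: nat
  assumes "t \<ge> 1" and "n \<ge> 4 * t"
  shows "\<exists>(V :: nat set) (E :: nat set set). optimal_outerthickness_graph t V E \<and> card V = n"
proof -
  obtain E f where pack: "packing t n E f" using packing_exists[OF assms] by blast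
  define G where "G = (\<Union>i<t. E i)"
  have sg: "simple_graph {..<n} (E i)" and card: "card (E i) = 2 * n - 3" and outer: "outerplanar {..<n} (E i)"
    if "i < t" for i
    using pack that noncrossing_imp_outerplanar by (auto simp: packing_def)
  have disj: "E i \<inter> E j = {}" if "i < t" "j < t" "i \<noteq> j" for i j using pack that by (auto simp: packing_def)
  \<comment> \<open>Nonempty classes are required by \<open>partition_on\<close>, and they also make
    the disjoint sets \<open>E i\<close> distinct.\<close>
  have ne: "E i \<noteq> {}" if "i < t" for i using card[OF that] assms by fastforce
  have cardG: "card G = t * (2 * n - 3)"
    unfolding G_def using card disj simple_graph_finite_edges[OF sg]
    by (subst card_UN_disjoint) auto
  let ?P = "E ` {..<t}"
  have "inj_on E {..<t}" using disj ne by (fastforce simp: inj_on_def)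
  then have "card ?P = t" by (simp add: card_image)
  moreover have "partition_on G ?P"
    unfolding partition_on_def G_def disjoint_def using disj ne by fastforce
  ultimately have upper: "\<exists>P. partition_on G P \<and> finite P \<and> card P = t \<and> (\<forall>F\<in>P. outerplanar {..<n} F)"
    using outer by (intro exI[of _ ?P]) auto
  have lower: "t \<le> s"
    if P: "partition_on G P" "finite P" "card P = s" "\<forall>F\<in>P. outerplanar {..<n} F" for P s
  proof (rule ccontr)
    assume "\<not> t \<le> s"
    then obtain d where d: "t = s + 1 + d" by (metis add.commute add_Suc_right less_iff_Suc_add not_le plus_1_eq_Suc)
    have "t * (2 * n - 3) \<le> s * (2 * n - 2)"
    proof -
      have "card G \<le> card P * (2 * card {..<n} - 2)"
        by (rule outerplanar_partition_card[OF P(1,2)]) (use P(4) assms in \<open>auto simp: lessThan_empty_iff\<close>)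
      then show ?thesis using P(3) cardG by simp
    qed
    \<comment> \<open>The weaker edge bound costs only \<open>s\<close> in total, while a missing
      class costs at least \<open>2 * n - 3\<close>; this exceeds \<open>s\<close>, as
      \<open>s < t\<close> and \<open>4 * t \<le> n\<close>.\<close>
    moreover have "s * (2 * n - 2) = s * (2 * n - 3) + s" using assms by (cases n) (auto simp: algebra_simps)
    moreover have "t * (2 * n - 3) = s * (2 * n - 3) + (1 + d) * (2 * n - 3)"
      unfolding d by (simp only: add_mult_distrib add.assoc)
    moreover have "1 * (2 * n - 3) \<le> (1 + d) * (2 * n - 3)" by (rule mult_le_mono1) simp
    ultimately show False using assms d by simp
  qed
  have "outerthickness {..<n} G = t"
    unfolding outerthickness_def by (rule Least_equality) (use upper lower in auto)
  moreover have "simple_graph {..<n} G"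
    using sg unfolding simple_graph_def G_def by blast
  ultimately have "optimal_outerthickness_graph t {..<n} G"
    using cardG assms by (simp add: optimal_outerthickness_graph_def)
  then show ?thesis by (intro exI[of _ "{..<n}"] exI[of _ G]) simp
qed

end
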